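(* Let $X$ be a $\mathrm{CAT}(0)$ space and $C \subseteq X$ a nonempty convex subset. Let $T,U:C \to C$ be nonexpansive mappings such that $F:=\mathrm{Fix}(T) \cap \mathrm{Fix}(U) \neq \emptyset$. Let $(\alpha_n),(\beta_n) \subset [0,1]$ and $u,x_0 \in C$. Assume that $\Gamma_1,\Gamma_3,\Gamma_4:(0,+\infty)\to\mathbb{N}$ and $\Gamma_2:\mathbb{N}\to\mathbb{N}$ are monotone functions and $\gamma\in(0,1)$ is a constant such that: (Q1) for all $\varepsilon>0$ and all $n\ge\Gamma_1(\varepsilon)$, $\alpha_n\le\varepsilon$; (Q2) for all $k\in\mathbb{N}$, $\sum_{i=0}^{\Gamma_2(k)}\alpha_i\ge k$; (Q3) for all $\varepsilon>0$ and $n\in\mathbb{N}$, $\sum_{i=\Gamma_3(\varepsilon)+1}^{\Gamma_3(\varepsilon)+n}|\alpha_{i+1}-\alpha_i|\le\varepsilon$; (Q4) for all $\varepsilon>0$ and $n\in\mathbb{N}$, $\sum_{i=\Gamma_4(\varepsilon)+1}^{\Gamma_4(\varepsilon)+n}|\beta_{i+1}-\beta_i|\le\varepsilon$; (Q5) $\gamma\le\beta_n\le1-\gamma$ for all $n\in\mathbb{N}$. Let $N\in\mathbb{N}\setminus\{0\}$ be such that $N\geq \max\{d(x_0,p),2 d(u,p)\}$ for some $p\in F$. Let $(x_n)$ be generated from $x_0$ by $$x_{2n+1}=(1-\alpha_n)T(x_{2n})\oplus \alpha_n u,\qquad x_{2n+2}=(1-\beta_n)U(x_{2n+1})\oplus\beta_nx_{2n+1}\qquad(n\in\mathbb{N}).$$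 Then $(x_n)$ is a Cauchy sequence with rate of metastability $$\mu(\varepsilon,f):=2\max\left\{\Sigma\left(\Psi\left(\tfrac{\tilde{\varepsilon}}{24}, \Delta_{\varepsilon,f}\right)\right), \theta_4\left(\tfrac{\varepsilon}{4}\right) \right\} +1,$$ that is, for all $\varepsilon>0$ and all $f:\mathbb{N}\to\mathbb{N}$ there is $n\le\mu(\varepsilon,f)$ such that $d(x_i,x_j)\le\varepsilon$ for all $i,j\in[n,f(n)]$. Here $\tilde\varepsilon$, $\Sigma$, $\Psi$, $\Delta_{\varepsilon,f}$, $\theta_4$ are the quantities explicitly defined in the context from $N,\gamma,\Gamma_1,\Gamma_2,\Gamma_3,\Gamma_4$ (and $\varepsilon,f$).
   Context: A $\mathrm{CAT}(0)$ space is a metric space $(X,d)$ with a map $W:X\times X\times[0,1]\to X$ such that for all $x,y,z,w\in X$ and $\lambda,\lambda'\in[0,1]$: (W1) $d(z,W(x,y,\lambda))\le(1-\lambda)d(z,x)+\lambda d(z,y)$; (W2) $d(W(x,y,\lambda),W(x,y,\lambda'))=|\lambda-\lambda'|d(x,y)$; (W3) $W(x,y,\lambda)=W(y,x,1-\lambda)$; (W4) $d(W(x,y,\lambda),W(z,w,\lambda))\le(1-\lambda)d(x,z)+\lambda d(y,w)$; and (CN$^-$) $d^2(z,W(x,y,\tfrac12))\le\tfrac12d^2(z,x)+\tfrac12d^2(z,y)-\tfrac14d^2(x,y)$. One writes $(1-\lambda)x\oplus\lambda y:=W(x,y,\lambda)$. A subset $C$ is convex if $(1-\lambda)x\oplus\lambda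 y\in C$ for all $x,y\in C$, $\lambda\in[0,1]$. $T$ is nonexpansive if $d(T(x),T(y))\le d(x,y)$. Monotone: $\varepsilon\le\varepsilon'$ implies $\Gamma_i(\varepsilon)\ge\Gamma_i(\varepsilon')$ for $i=1,3,4$; $k\le k'$ implies $\Gamma_2(k)\le\Gamma_2(k')$. For integers, $[n,m]$ denotes $\{n,n+1,\dots,m\}$ (empty if $m<n$). $\lceil x\rceil$ denotes the maximum of $0$ and the usual ceiling of $x$. Definitions (for $\varepsilon>0$): $V(\varepsilon):=\max\{\Gamma_3(\tfrac{\varepsilon}{4N}),\Gamma_4(\tfrac{\varepsilon}{4N})\}$; $\theta_1(\varepsilon):=\Gamma_2\big(V(\tfrac{\varepsilon}{2})+\lceil\ln(\tfrac{4N}{\varepsilon})\rceil+2\big)+1$; $\theta_3(\varepsilon):=\max\{\theta_1(\tfrac{(\gamma\varepsilon)^2}{8N}),\Gamma_1(\tfrac{(\gamma\varepsilon)^2}{2N^2})\}$; $\theta_4(\varepsilon):=\max\{\theta_1(\tfrac\varepsilon2),\theta_3(\tfrac\varepsilon2)\}$; $\rho_2(\varepsilon):=2\theta_3(\tfrac\varepsilon3)+2$; $\rho_3(\varepsilon):=2\max\{\theta_4(\tfrac\varepsilon6),\Gamma_1(\tfrac{\varepsilon}{4N})\}+1$; $\rho(\varepsilon):=\max\{\rho_2(\varepsilon),\rho_3(\varepsilon)\}$. For $\delta:(0,1]\to(0,1]$: $\varphi(\varepsilon,\delta):=\min\{\delta^{(i)}(1):0\le i\le\lceil\tfrac{N^2}{4\varepsilon}\rceil\}$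 ($\delta^{(i)}$ the $i$-fold iterate), and $\Phi(\varepsilon,\delta):=\tfrac{1}{24N}\,\varphi(\tfrac{\varepsilon^2}{4N^2},\tilde\delta)^2$ with $\tilde\delta(\xi):=\min\{\delta(\tfrac{\xi^2}{24N}),\tfrac{\xi^2}{24N}\}$. For $\Delta:\mathbb{N}\to(0,1]$: $\Psi(\varepsilon,\Delta):=\rho(\Phi(\varepsilon,\overline\Delta))$ with $\overline\Delta(\eta):=\Delta(\rho(\eta))$ for $\eta\in(0,1]$. For given $\varepsilon>0$, $f:\mathbb{N}\to\mathbb{N}$: $\tilde\varepsilon:=\tfrac{\varepsilon^2}{16}$; $K(n):=\max\{n,\rho_3(\tfrac{\tilde\varepsilon}{36N})\}$; $\Sigma(n):=\Gamma_2\big(K(n)+\lceil\ln(\tfrac{12N^2}{\tilde\varepsilon})\rceil\big)+1$; $P(n):=f\big(2\max\{\Sigma(n),\theta_4(\tfrac\varepsilon4)\}+1\big)$; $\Delta_{\varepsilon,f}(n):=\min\{\tfrac{\tilde\varepsilon}{30N(P(n)+1)},1\}$. *)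

theory Defs
  imports "HOL-Analysis.Analysis"
begin

text \<open>The point \<open>W x y t\<close> stands for \<open>(1 - t) x \<oplus> t y\<close>.\<close>

locale cat0_space =
  fixes W :: "'a::metric_space \<Rightarrow> 'a \<Rightarrow> real \<Rightarrow> 'a"
  assumes W1: "\<And>x y z t. t \<in> {0..1} \<Longrightarrow>
      dist z (W x y t) \<le> (1 - t) * dist z x + t * dist z y"
    and W2: "\<And>x y s t. s \<in> {0..1} \<Longrightarrow> t \<in> {0..1} \<Longrightarrow>
      dist (W x y s) (W x y t) = \<bar>s - t\<bar> * dist x y"
    and W3: "\<And>x y t. t \<in> {0..1} \<Longrightarrow> W x y t = W y x (1 - t)"
    and W4: "\<And>x y z w t. t \<in> {0..1} \<Longrightarrow>
      dist (W x y t) (W z w t) \<le> (1 - t) * dist x z + t * dist y w"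
    and CN_minus: "\<And>x y z. (dist z (W x y (1/2)))\<^sup>2
      \<le> 1/2 * (dist z x)\<^sup>2 + 1/2 * (dist z y)\<^sup>2 - 1/4 * (dist x y)\<^sup>2"

definition geodesically_convex :: "('a \<Rightarrow> 'a \<Rightarrow> real \<Rightarrow> 'a) \<Rightarrow> 'a set \<Rightarrow> bool" where
  "geodesically_convex W C \<longleftrightarrow> (\<forall>x\<in>C. \<forall>y\<in>C. \<forall>t\<in>{0..1}. W x y t \<in> C)"

definition nonexpansive_on :: "'a::metric_space set \<Rightarrow> ('a \<Rightarrow> 'a) \<Rightarrow> bool" where
  "nonexpansive_on C T \<longleftrightarrow> (\<forall>x\<in>C. \<forall>y\<in>C. dist (T x) (T y) \<le> dist x y)"

definition Fix_on :: "'a set \<Rightarrow> ('a \<Rightarrow> 'a) \<Rightarrow> 'a set" where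
  "Fix_on C T = {p \<in> C. T p = p}"

text \<open>Since \<open>{n..f n}\<close> is empty when \<open>f n < n\<close>, no condition on \<open>f\<close> is needed.\<close>

definition metastability_rate ::
    "(nat \<Rightarrow> 'a::metric_space) \<Rightarrow> (real \<Rightarrow> (nat \<Rightarrow> nat) \<Rightarrow> nat) \<Rightarrow> bool" where
  "metastability_rate x m \<longleftrightarrow>
    (\<forall>\<epsilon>>0. \<forall>f. \<exists>n\<le>m \<epsilon> f. \<forall>i\<in>{n..f n}. \<forall>j\<in>{n..f n}. dist (x i) (x j) \<le> \<epsilon>)"

text \<open>
  In the quantitative bounds, functions on the positive reals and on \<open>(0,1]\<close> are total functions
  on \<^typ>\<open>real\<close> of which only the values there matter, and \<open>nat \<lceil>r\<rceil>\<close> is the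
  maximum of \<open>0\<close> and the ceiling of \<open>r\<close>. Outside the context below, every constant takes those of
  the parameters \<open>N\<close>, \<open>\<gamma>\<close>, \<open>\<Gamma>\<^sub>1\<close>, \<open>\<Gamma>\<^sub>2\<close>, \<open>\<Gamma>\<^sub>3\<close>, \<open>\<Gamma>\<^sub>4\<close> on which it depends as additional leading
  arguments, in this order.
\<close>

context
  fixes N :: nat and \<gamma> :: real
    and \<Gamma>\<^sub>1 :: "real \<Rightarrow> nat" and \<Gamma>\<^sub>2 :: "nat \<Rightarrow> nat"
    and \<Gamma>\<^sub>3 :: "real \<Rightarrow> nat" and \<Gamma>\<^sub>4 :: "real \<Rightarrow> nat"
begin

definition V_bound :: "real \<Rightarrow> nat" where
  "V_bound \<epsilon> = max (\<Gamma>\<^sub>3 (\<epsilon> / (4 * real N))) (\<Gamma>\<^sub>4 (\<epsilon> / (4 * real N)))"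

definition theta1 :: "real \<Rightarrow> nat" where
  "theta1 \<epsilon> = \<Gamma>\<^sub>2 (V_bound (\<epsilon> / 2) + nat \<lceil>ln (4 * real N / \<epsilon>)\<rceil> + 2) + 1"

definition theta3 :: "real \<Rightarrow> nat" where
  "theta3 \<epsilon> = max (theta1 ((\<gamma> * \<epsilon>)\<^sup>2 / (8 * real N)))
    (\<Gamma>\<^sub>1 ((\<gamma> * \<epsilon>)\<^sup>2 / (2 * (real N)\<^sup>2)))"

definition theta4 :: "real \<Rightarrow> nat" where
  "theta4 \<epsilon> = max (theta1 (\<epsilon> / 2)) (theta3 (\<epsilon> / 2))"

definition rho2 :: "real \<Rightarrow> nat" where
  "rho2 \<epsilon> = 2 * theta3 (\<epsilon> / 3) + 2"

definition rho3 :: "real \<Rightarrow> nat" where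
  "rho3 \<epsilon> = 2 * max (theta4 (\<epsilon> / 6)) (\<Gamma>\<^sub>1 (\<epsilon> / (4 * real N))) + 1"

definition rho :: "real \<Rightarrow> nat" where
  "rho \<epsilon> = max (rho2 \<epsilon>) (rho3 \<epsilon>)"

definition phi_small :: "real \<Rightarrow> (real \<Rightarrow> real) \<Rightarrow> real" where
  "phi_small \<epsilon> \<delta> = Min ((\<lambda>i. (\<delta> ^^ i) 1) ` {0..nat \<lceil>(real N)\<^sup>2 / (4 * \<epsilon>)\<rceil>})"

definition delta_tilde :: "(real \<Rightarrow> real) \<Rightarrow> real \<Rightarrow> real" where
  "delta_tilde \<delta> \<xi> = min (\<delta> (\<xi>\<^sup>2 / (24 * real N))) (\<xi>\<^sup>2 / (24 * real N))"

definition Phi_big :: "real \<Rightarrow> (real \<Rightarrow> real) \<Rightarrow> real" where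
  "Phi_big \<epsilon> \<delta> =
    1 / (24 * real N) * (phi_small (\<epsilon>\<^sup>2 / (4 * (real N)\<^sup>2)) (delta_tilde \<delta>))\<^sup>2"

definition Psi_bound :: "real \<Rightarrow> (nat \<Rightarrow> real) \<Rightarrow> nat" where
  "Psi_bound \<epsilon> \<Delta> = rho (Phi_big \<epsilon> (\<lambda>\<eta>. \<Delta> (rho \<eta>)))"

definition eps_tilde :: "real \<Rightarrow> real" where
  "eps_tilde \<epsilon> = \<epsilon>\<^sup>2 / 16"

definition K_bound :: "real \<Rightarrow> nat \<Rightarrow> nat" where
  "K_bound \<epsilon> n = max n (rho3 (eps_tilde \<epsilon> / (36 * real N)))"

definition Sigma_bound :: "real \<Rightarrow> nat \<Rightarrow> nat" where
  "Sigma_bound \<epsilon> n =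
    \<Gamma>\<^sub>2 (K_bound \<epsilon> n + nat \<lceil>ln (12 * (real N)\<^sup>2 / eps_tilde \<epsilon>)\<rceil>) + 1"

definition P_bound :: "real \<Rightarrow> (nat \<Rightarrow> nat) \<Rightarrow> nat \<Rightarrow> nat" where
  "P_bound \<epsilon> f n = f (2 * max (Sigma_bound \<epsilon> n) (theta4 (\<epsilon> / 4)) + 1)"

definition Delta_fun :: "real \<Rightarrow> (nat \<Rightarrow> nat) \<Rightarrow> nat \<Rightarrow> real" where
  "Delta_fun \<epsilon> f n = min (eps_tilde \<epsilon> / (30 * real N * (real (P_bound \<epsilon> f n) + 1))) 1"

definition mu :: "real \<Rightarrow> (nat \<Rightarrow> nat) \<Rightarrow> nat" where
  "mu \<epsilon> f =
    2 * max (Sigma_bound \<epsilon> (Psi_bound (eps_tilde \<epsilon> / 24) (Delta_fun \<epsilon> f))) (theta4 (\<epsilon> / 4)) + 1"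

end

end

theory Submission
  imports Defs
begin

text \<open>
  Two estimates carry the proof; both come from the same scalar recursion
  \<open>a\<^sub>m\<^sub>+\<^sub>1 \<le> (1 - \<alpha>\<^sub>m) a\<^sub>m + \<alpha>\<^sub>m b + c\<^sub>m\<close> (\<open>halpern_recursion_bound\<close>), in which the divergence of
  \<open>\<Sum>\<alpha>\<^sub>m\<close> erases the initial value.

  The first is asymptotic regularity. With \<open>a\<^sub>n = d(x\<^bsub>2n+2\<^esub>, x\<^bsub>2n\<^esub>)\<close> the errors \<open>c\<^sub>n\<close> are multiples of
  \<open>\<bar>\<alpha>\<^sub>n\<^sub>+\<^sub>1 - \<alpha>\<^sub>n\<bar> + \<bar>\<beta>\<^sub>n\<^sub>+\<^sub>1 - \<beta>\<^sub>n\<bar>\<close>, which are summable, so \<open>a\<^sub>n\<close> tends to \<open>0\<close> with rate \<open>\<theta>\<^sub>1\<close>. The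
  even iterates then hardly move, so their distance to a common fixed point \<open>p\<close> hardly drops;
  but uniform convexity makes every Mann step with \<open>\<gamma> \<le> \<beta>\<^sub>n \<le> 1 - \<gamma>\<close> lower \<open>d(x, p)\<^sup>2\<close> by at least
  \<open>\<gamma>\<^sup>2 d(U x, x)\<^sup>2\<close>. Hence the \<open>U\<close>-residual tends to \<open>0\<close> (rate \<open>\<theta>\<^sub>3\<close>), and with it all the distances
  between neighbouring iterates and the residuals of \<open>T\<close> and \<open>U\<close> (rates \<open>\<theta>\<^sub>4\<close>, \<open>\<rho>\<^sub>3\<close>, \<open>\<rho>\<^sub>2\<close>).

  The second compares the iterates with the projection of the anchor \<open>u\<close> onto the common fixed
  points. In an incomplete space that projection may not exist, and where it exists it is the
  outcome of an infinite search and yields no explicit bound. It is replaced by a point \<open>z\<close> whose distance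
  to \<open>u\<close> is minimal up to a small error among the approximate common fixed points of some
  accuracy \<open>\<eta>\<close>, while \<open>z\<close> itself has an accuracy that depends on \<open>\<eta>\<close> in a prescribed way. Such a
  \<open>z\<close> exists because a squared distance can be lowered by \<open>\<epsilon>\<close> only boundedly often
  (\<open>approx_minimizer\<close>). Minimality on geodesics gives the variational inequality
  \<open>d(u,z)\<^sup>2 + d(z,y)\<^sup>2 - d(u,y)\<^sup>2 \<le> 2\<epsilon>\<close>, with \<open>y\<close> ranging over all late iterates.

  Now let \<open>a\<^sub>m = d(x\<^bsub>2m\<^esub>, z)\<^sup>2\<close>. In the recursion the variational inequality makes \<open>b\<close> small, and
  \<open>c\<^sub>m\<close> accounts for \<open>z\<close> being fixed only approximately. These errors do not sum to a finite value,
  but up to the index \<open>f n\<close> there are only finitely many of them, and \<open>z\<close> was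
  prescribed to be so accurate that their sum stays small. This is why the result is a bound for
  metastability; the Cauchy property follows by applying it to a counterexample function.
\<close>

section \<open>Geometry of CAT(0) spaces\<close>

context cat0_space
begin

lemma W_at_0: "W x y 0 = x"
  using W1[of 0 x x y] by simp

lemma W_at_1: "W x y 1 = y"
  using W1[of 1 y x y] by simp

lemma dist_W_left:
  assumes "t \<in> {0..1}"
  shows "dist (W x y t) x = t * dist x y"
  using W2[of t 0 x y] assms by (simp add: W_at_0)

lemma dist_W_right:
  assumes "t \<in> {0..1}"
  shows "dist (W x y t) y = (1 - t) * dist x y"
  using W2[of t 1 x y] assms by (simp add: W_at_1)

text \<open>
  A metric midpoint of two points has distance \<open>0\<close> to their \<open>W\<close>-midpoint by the inequality
  \<open>CN_minus\<close>, so midpoints are unique.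
\<close>

lemma W_midpoint:
  assumes s: "s \<in> {0..1}" and t: "t \<in> {0..1}"
  shows "W (W x y s) (W x y t) (1/2) = W x y ((s + t) / 2)"
proof -
  let ?a = "W x y s" and ?b = "W x y t" and ?m = "W x y ((s + t) / 2)"
  have st: "(s + t) / 2 \<in> {0..1}" using s t by auto
  have "dist ?m ?a = \<bar>(s + t) / 2 - s\<bar> * dist x y" by (rule W2[OF st s])
  also have "\<dots> = (\<bar>s - t\<bar> * dist x y) / 2" by (simp add: abs_if field_simps)
  finally have a: "dist ?m ?a = dist ?a ?b / 2" by (simp add: W2[OF s t])
  have "dist ?m ?b = \<bar>(s + t) / 2 - t\<bar> * dist x y" by (rule W2[OF st t])
  also have "\<dots> = (\<bar>s - t\<bar> * dist x y) / 2" by (simp add: abs_if field_simps)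
  finally have b: "dist ?m ?b = dist ?a ?b / 2" by (simp add: W2[OF s t])
  have "(dist ?m (W ?a ?b (1/2)))\<^sup>2 \<le> 0"
    using CN_minus[of ?m ?a ?b] by (simp add: a b power_divide)
  then show ?thesis by simp
qed

text \<open>
  The defect \<open>g\<close> of the inequality is midpoint convex in \<open>t\<close>, bounded and zero at both ends. Every
  \<open>t\<close> is the midpoint of an end and another parameter, so any upper bound for \<open>g\<close> can be halved
  again and again.
\<close>

lemma CN_inequality:
  assumes t: "t \<in> {0..1}"
  shows "(dist z (W x y t))\<^sup>2
    \<le> (1 - t) * (dist z x)\<^sup>2 + t * (dist z y)\<^sup>2 - t * (1 - t) * (dist x y)\<^sup>2"
proof -
  define g where "g t = (dist z (W x y t))\<^sup>2
    - ((1 - t) * (dist z x)\<^sup>2 + t * (dist z y)\<^sup>2 - t * (1 - t) * (dist x y)\<^sup>2)" for t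
  have mid: "g ((s + t) / 2) \<le> (g s + g t) / 2" if s: "s \<in> {0..1}" and t: "t \<in> {0..1}" for s t
  proof -
    have "(dist z (W x y ((s + t) / 2)))\<^sup>2 \<le> 1/2 * (dist z (W x y s))\<^sup>2
      + 1/2 * (dist z (W x y t))\<^sup>2 - 1/4 * ((s - t)\<^sup>2 * (dist x y)\<^sup>2)"
      using CN_minus[of z "W x y s" "W x y t"]
      by (simp add: W_midpoint[OF s t] W2[OF s t] power_mult_distrib)
    then show ?thesis unfolding g_def by (simp add: field_simps power2_eq_square)
  qed
  have g0: "g 0 = 0" and g1: "g 1 = 0" by (simp_all add: g_def W_at_0 W_at_1)
  define B where "B = (dist z x + dist x y)\<^sup>2 + (dist x y)\<^sup>2"
  have B: "g t \<le> B" if t: "t \<in> {0..1}" for t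
  proof -
    have "dist z (W x y t) \<le> dist z x + dist x (W x y t)" by (rule dist_triangle)
    also have "dist x (W x y t) \<le> dist x y"
      using t by (simp add: dist_commute[of x "W x y t"] dist_W_left mult_left_le_one_le)
    finally have "(dist z (W x y t))\<^sup>2 \<le> (dist z x + dist x y)\<^sup>2" by (simp add: power_mono)
    moreover have "t * (1 - t) * (dist x y)\<^sup>2 \<le> 1 * (dist x y)\<^sup>2"
      using t by (intro mult_right_mono) (auto intro: mult_le_one)
    moreover have "0 \<le> (1 - t) * (dist z x)\<^sup>2" "0 \<le> t * (dist z y)\<^sup>2" using t by auto
    ultimately show ?thesis unfolding g_def B_def by linarith
  qed
  have halve: "g t \<le> B / 2 ^ n" if "t \<in> {0..1}" for t n
    using that
  proof (induction n arbitrary: t)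
    case 0
    then show ?case using B by simp
  next
    case (Suc n)
    show ?case
    proof (cases "t \<le> 1/2")
      case True
      then have "2 * t \<in> {0..1}" using Suc.prems by simp
      then show ?thesis using mid[of 0 "2 * t"] Suc.IH[of "2 * t"] by (simp add: g0)
    next
      case False
      then have "2 * t - 1 \<in> {0..1}" using Suc.prems by simp
      then show ?thesis using mid[of 1 "2 * t - 1"] Suc.IH[of "2 * t - 1"] by (simp add: g1)
    qed
  qed
  have "(\<lambda>n. B * (1/2) ^ n) \<longlonglongrightarrow> B * 0"
    by (intro tendsto_intros) (auto intro: LIMSEQ_realpow_zero)
  then have "g t \<le> 0"
    using halve[OF t] by (intro LIMSEQ_le_const) (auto simp: power_divide)
  then show ?thesis by (simp add: g_def)
qed

text \<open>
  A nonexpansive map sends a point \<open>w\<close> of the geodesic between two fixed points to a point with at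
  most the same distances to both ends, which by the inequality above must be \<open>w\<close>. With residual \<open>\<eta>\<close> at the
  ends the two distances grow by at most \<open>\<eta>\<close> and the square of the new residual is of order \<open>\<eta>\<close>.
\<close>

lemma approx_fixed_point_on_geodesic:
  assumes T: "nonexpansive_on C T" and C: "geodesically_convex W C"
    and x: "x \<in> C" and y: "y \<in> C" and t: "t \<in> {0..1}"
    and Tx: "dist (T x) x \<le> \<eta>" and Ty: "dist (T y) y \<le> \<eta>"
  shows "(dist (T (W x y t)) (W x y t))\<^sup>2 \<le> \<eta> * dist x y + \<eta>\<^sup>2"
proof -
  let ?w = "W x y t" and ?D = "dist x y"
  have w: "?w \<in> C" using C x y t by (auto simp: geodesically_convex_def)
  have "dist (T ?w) (T x) \<le> dist ?w x" "dist (T ?w) (T y) \<le> dist ?w y"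
    using T w x y by (auto simp: nonexpansive_on_def)
  then have wx: "dist (T ?w) x \<le> t * ?D + \<eta>" and wy: "dist (T ?w) y \<le> (1 - t) * ?D + \<eta>"
    using dist_triangle[of "T ?w" x "T x"] dist_triangle[of "T ?w" y "T y"] Tx Ty
      dist_W_left[OF t, of x y] dist_W_right[OF t, of x y] by linarith+
  have \<eta>: "0 \<le> \<eta>" using Tx zero_le_dist[of "T x" x] by linarith
  have "(dist (T ?w) ?w)\<^sup>2
    \<le> (1 - t) * (dist (T ?w) x)\<^sup>2 + t * (dist (T ?w) y)\<^sup>2 - t * (1 - t) * ?D\<^sup>2"
    by (rule CN_inequality[OF t])
  also have "\<dots> \<le> (1 - t) * (t * ?D + \<eta>)\<^sup>2 + t * ((1 - t) * ?D + \<eta>)\<^sup>2 - t * (1 - t) * ?D\<^sup>2"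
    using t wx wy by (intro diff_right_mono add_mono mult_left_mono power_mono) auto
  also have "\<dots> = (4 * t * (1 - t)) * (\<eta> * ?D) + \<eta>\<^sup>2"
    by (simp add: algebra_simps power2_eq_square)
  also have "\<dots> \<le> 1 * (\<eta> * ?D) + \<eta>\<^sup>2"
  proof -
    have "0 \<le> (2 * t - 1)\<^sup>2" by simp
    then have "4 * t * (1 - t) \<le> 1" by (simp add: algebra_simps power2_eq_square)
    then show ?thesis using \<eta> by (intro add_right_mono mult_right_mono) auto
  qed
  finally show ?thesis by simp
qed

text \<open>
  In a Hilbert space the left-hand side is \<open>2\<langle>u - x, y - x\<rangle>\<close>. Near-minimality of \<open>x\<close> on the geodesic
  to \<open>y\<close> yields it up to the error \<open>\<epsilon>\<^sup>2 / (t R\<^sup>2) + t R\<^sup>2\<close>, which \<open>t = \<epsilon> / R\<^sup>2\<close> makes equal to \<open>2\<epsilon>\<close>.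
  If this \<open>t\<close> exceeds \<open>1\<close>, then the Cauchy-Schwarz bound \<open>2 d(u,x) d(x,y) \<le> 2R\<^sup>2\<close> is already enough.
\<close>

lemma variational_inequality:
  assumes \<epsilon>: "0 < \<epsilon>" and R: "0 < R" and ux: "dist u x \<le> R" and xy: "dist x y \<le> R"
    and min: "\<And>t. t \<in> {0..1} \<Longrightarrow> (dist u x)\<^sup>2 \<le> (dist u (W x y t))\<^sup>2 + \<epsilon>\<^sup>2 / R\<^sup>2"
  shows "(dist u x)\<^sup>2 + (dist x y)\<^sup>2 - (dist u y)\<^sup>2 \<le> 2 * \<epsilon>"
proof (cases "\<epsilon> \<le> R\<^sup>2")
  case True
  define t where "t = \<epsilon> / R\<^sup>2"
  have t: "t \<in> {0..1}" and t0: "0 < t" using True \<epsilon> R by (auto simp: t_def)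
  have eq: "\<epsilon>\<^sup>2 / R\<^sup>2 = t * \<epsilon>" by (simp add: t_def power2_eq_square)
  have "(dist u x)\<^sup>2 \<le> (1 - t) * (dist u x)\<^sup>2 + t * (dist u y)\<^sup>2 - t * (1 - t) * (dist x y)\<^sup>2 + t * \<epsilon>"
    using min[OF t] CN_inequality[OF t, of u x y] unfolding eq by linarith
  then have "t * ((dist u x)\<^sup>2 + (dist x y)\<^sup>2 - (dist u y)\<^sup>2) \<le> t * (\<epsilon> + t * (dist x y)\<^sup>2)"
    by (simp add: algebra_simps power2_eq_square)
  then have "(dist u x)\<^sup>2 + (dist x y)\<^sup>2 - (dist u y)\<^sup>2 \<le> \<epsilon> + t * (dist x y)\<^sup>2"
    using t0 by simp
  also have "\<dots> \<le> \<epsilon> + t * R\<^sup>2" using xy t0 by (simp add: power_mono)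
  also have "t * R\<^sup>2 = \<epsilon>" using R by (simp add: t_def)
  finally show ?thesis by simp
next
  case False
  have "\<bar>dist u x - dist x y\<bar> \<le> \<bar>dist u y\<bar>"
    using dist_triangle[of u x y] dist_triangle[of x y u] by (simp add: dist_commute abs_le_iff)
  then have "(dist u x - dist x y)\<^sup>2 \<le> (dist u y)\<^sup>2" by (simp only: abs_le_square_iff)
  then have "(dist u x)\<^sup>2 + (dist x y)\<^sup>2 - (dist u y)\<^sup>2 \<le> 2 * (dist u x * dist x y)"
    by (simp add: power2_eq_square algebra_simps)
  also have "\<dots> \<le> 2 * (R * R)" using ux xy R by (intro mult_left_mono mult_mono) auto
  also have "\<dots> \<le> 2 * \<epsilon>" using False by (simp add: power2_eq_square)
  finally show ?thesis .
qed

end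

section \<open>Real sequences and approximate minimisers\<close>

lemma even_odd_cases:
  obtains (even) k where "n = 2 * k" | (odd) k where "n = 2 * k + (1::nat)"
  by (metis evenE oddE)

lemma dist_square_diff_le:
  fixes a b z :: "'c::metric_space"
  assumes "dist a z \<le> R" "dist b z \<le> R"
  shows "(dist a z)\<^sup>2 - (dist b z)\<^sup>2 \<le> 2 * R * dist a b"
proof -
  have "(dist a z)\<^sup>2 - (dist b z)\<^sup>2 = (dist a z + dist b z) * (dist a z - dist b z)"
    by (simp add: power2_eq_square algebra_simps)
  also have "\<dots> \<le> (dist a z + dist b z) * dist a b"
    using dist_triangle[of a z b] by (intro mult_left_mono) auto
  also have "\<dots> \<le> (2 * R) * dist a b" using assms by (intro mult_right_mono) auto
  finally show ?thesis .
qed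

lemma sum_tail_le:
  fixes d :: "nat \<Rightarrow> real"
  assumes "\<And>n. (\<Sum>i=G + 1..G + n. d i) \<le> e" "\<And>i. 0 \<le> d i" "G \<le> V"
  shows "(\<Sum>i=V + 1..<n. d i) \<le> e"
proof -
  have "(\<Sum>i=V + 1..<n. d i) \<le> (\<Sum>i=G + 1..G + n. d i)"
    using assms(2,3) by (intro sum_mono2) auto
  then show ?thesis using assms(1)[of n] by linarith
qed

text \<open>
  Since \<open>1 - g \<le> exp (- g)\<close>, the weights on the initial value multiply to a small exponential, while
  the contributions of \<open>b\<close> enter by convex combinations and never exceed \<open>b\<close> in total.
\<close>

lemma halpern_recursion_bound:
  fixes a g c :: "nat \<Rightarrow> real"
  assumes "m \<le> n" and A: "a m \<le> A" "0 \<le> A"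
    and g: "\<And>i. m \<le> i \<Longrightarrow> i < n \<Longrightarrow> g i \<in> {0..1}"
    and c: "\<And>i. m \<le> i \<Longrightarrow> i < n \<Longrightarrow> 0 \<le> c i" and "0 \<le> b"
    and step: "\<And>i. m \<le> i \<Longrightarrow> i < n \<Longrightarrow> a (Suc i) \<le> (1 - g i) * a i + g i * b + c i"
  shows "a n \<le> exp (- (\<Sum>i=m..<n. g i)) * A + b + (\<Sum>i=m..<n. c i)"
  using \<open>m \<le> n\<close> g c step
proof (induction n rule: dec_induct)
  case base
  then show ?case using A \<open>0 \<le> b\<close> by simp
next
  case (step n)
  define E where "E = exp (- (\<Sum>i=m..<n. g i))"
  define S where "S = (\<Sum>i=m..<n. c i)"
  have S: "0 \<le> S" unfolding S_def using step.prems(2) by (intro sum_nonneg) auto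
  have gn: "g n \<in> {0..1}" using step.prems(1) step.hyps by simp
  have IH: "a n \<le> E * A + b + S"
    unfolding E_def S_def using step.prems by (intro step.IH) auto
  have "a (Suc n) \<le> (1 - g n) * a n + g n * b + c n" using step.prems(3) step.hyps by simp
  also have "\<dots> \<le> (1 - g n) * (E * A + b + S) + g n * b + c n"
    using IH gn by (intro add_right_mono mult_left_mono) auto
  also have "\<dots> = (1 - g n) * (E * A) + b + (S + c n) - g n * S" by (simp add: algebra_simps)
  also have "\<dots> \<le> (1 - g n) * (E * A) + b + (S + c n)" using gn S by simp
  also have "\<dots> \<le> exp (- g n) * (E * A) + b + (S + c n)"
    using exp_ge_add_one_self[of "- g n"] A by (intro add_right_mono mult_right_mono) (auto simp: E_def)
  also have "exp (- g n) * (E * A) = exp (- (\<Sum>i=m..<Suc n. g i)) * A"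
    using step.hyps by (simp add: E_def mult.assoc[symmetric] exp_add[symmetric])
  finally show ?case using step.hyps by (simp add: S_def)
qed

text \<open>
  The accuracies \<open>(\<delta> ^^ i) 1\<close> are tried from the last one down to \<open>1\<close>, starting with \<open>p\<close>. If the
  current point is not a near-minimiser, then a point witnessing this has a value of \<open>h\<close> lower by
  more than \<open>\<epsilon>\<close>, and it has exactly the accuracy required of a candidate in the next trial. After
  more than \<open>M / \<epsilon>\<close> failures \<open>h\<close> would be negative.
\<close>

lemma approx_minimizer:
  fixes h :: "'b \<Rightarrow> real" and S :: "real \<Rightarrow> 'b set"
  assumes \<epsilon>: "0 < \<epsilon>" and h: "\<And>y. 0 \<le> h y" and p: "h p \<le> M" "\<And>i. p \<in> S ((\<delta> ^^ i) 1)"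
  shows "\<exists>i\<le>nat \<lceil>M / \<epsilon>\<rceil>. \<exists>z\<in>S (\<delta> ((\<delta> ^^ i) 1)). \<forall>y\<in>S ((\<delta> ^^ i) 1). h z \<le> h y + \<epsilon>"
proof (rule ccontr)
  define r where "r = nat \<lceil>M / \<epsilon>\<rceil>"
  assume "\<not> ?thesis"
  then have "\<forall>i\<le>r. \<forall>z\<in>S ((\<delta> ^^ Suc i) 1). \<exists>y\<in>S ((\<delta> ^^ i) 1). \<not> h z \<le> h y + \<epsilon>"
    unfolding r_def by simp
  then have less: "\<exists>y\<in>S ((\<delta> ^^ i) 1). h y + \<epsilon> < h z"
    if "i \<le> r" "z \<in> S ((\<delta> ^^ Suc i) 1)" for i z
    using that unfolding not_le by blast
  have "\<exists>y\<in>S ((\<delta> ^^ (Suc r - j)) 1). h y + real j * \<epsilon> \<le> M" if "j \<le> Suc r" for j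
    using that
  proof (induction j)
    case 0
    then show ?case using p(1) p(2)[of "Suc r"] by (intro bexI[of _ p]) auto
  next
    case (Suc j)
    then obtain z where z: "z \<in> S ((\<delta> ^^ (Suc r - j)) 1)" "h z + real j * \<epsilon> \<le> M" by auto
    have "Suc r - j = Suc (r - j)" using Suc.prems by simp
    then obtain y where y: "y \<in> S ((\<delta> ^^ (r - j)) 1)" "h y + \<epsilon> < h z"
      using less[of "r - j" z] z by auto
    then show ?case using z by (intro bexI[of _ y]) (auto simp: algebra_simps)
  qed
  from this[of "Suc r"] obtain y where "h y + real (Suc r) * \<epsilon> \<le> M" by auto
  then have "real (Suc r) * \<epsilon> \<le> M" using h[of y] by linarith
  moreover have "M / \<epsilon> \<le> real r" unfolding r_def by linarith
  then have "M \<le> real r * \<epsilon>" using \<epsilon> by (simp add: field_simps)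
  ultimately show False using \<epsilon> by (simp add: algebra_simps)
qed

text \<open>
  If \<open>x\<close> is not Cauchy, some \<open>e\<close> is attained by a pair of indices beyond each \<open>n\<close>; for the function
  that bounds these pairs, no \<open>n\<close> is a point of metastability for \<open>e / 2\<close>.
\<close>

lemma Cauchy_if_metastable:
  assumes "metastability_rate x m"
  shows "Cauchy x"
proof (rule ccontr)
  assume "\<not> Cauchy x"
  then obtain e where e: "0 < e" and "\<And>n. \<exists>i\<ge>n. \<exists>j\<ge>n. e \<le> dist (x i) (x j)"
    unfolding Cauchy_def by (force simp: not_less)
  then obtain I J where IJ: "\<And>n. n \<le> I n" "\<And>n. n \<le> J n" "\<And>n. e \<le> dist (x (I n)) (x (J n))"
    by metis
  have "0 < e / 2" using e by simp
  then obtain n where n: "\<forall>i\<in>{n..max (I n) (J n)}. \<forall>j\<in>{n..max (I n) (J n)}. dist (x i) (x j) \<le> e / 2"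
    using assms[unfolded metastability_rate_def, rule_format, of "e / 2" "\<lambda>n. max (I n) (J n)"]
    by blast
  then have "dist (x (I n)) (x (J n)) \<le> e / 2" using IJ by auto
  then show False using IJ(3)[of n] e by linarith
qed

section \<open>Asymptotic regularity of the alternating Halpern-Mann iteration\<close>

locale halpern_mann = cat0_space W for W :: "'a::metric_space \<Rightarrow> 'a \<Rightarrow> real \<Rightarrow> 'a" +
  fixes C :: "'a set" and T U :: "'a \<Rightarrow> 'a"
    and \<alpha> \<beta> :: "nat \<Rightarrow> real" and u p :: 'a and x :: "nat \<Rightarrow> 'a"
    and \<Gamma>\<^sub>1 \<Gamma>\<^sub>3 \<Gamma>\<^sub>4 :: "real \<Rightarrow> nat" and \<Gamma>\<^sub>2 :: "nat \<Rightarrow> nat"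
    and \<gamma> :: real and N :: nat
  assumes convex: "geodesically_convex W C"
    and T_in: "T \<in> C \<rightarrow> C" and U_in: "U \<in> C \<rightarrow> C"
    and T_ne: "nonexpansive_on C T" and U_ne: "nonexpansive_on C U"
    and \<alpha>: "\<And>n. \<alpha> n \<in> {0..1}"
    and u: "u \<in> C" and x0: "x 0 \<in> C"
    and \<Gamma>1: "antimono_on {0<..} \<Gamma>\<^sub>1" and \<Gamma>2: "mono \<Gamma>\<^sub>2"
    and \<Gamma>3: "antimono_on {0<..} \<Gamma>\<^sub>3" and \<Gamma>4: "antimono_on {0<..} \<Gamma>\<^sub>4"
    and \<gamma>: "0 < \<gamma>"
    and Q1: "\<And>\<epsilon> n. \<epsilon> > 0 \<Longrightarrow> n \<ge> \<Gamma>\<^sub>1 \<epsilon> \<Longrightarrow> \<alpha> n \<le> \<epsilon>"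
    and Q2: "\<And>k. (\<Sum>i=0..\<Gamma>\<^sub>2 k. \<alpha> i) \<ge> real k"
    and Q3: "\<And>\<epsilon> n. \<epsilon> > 0 \<Longrightarrow> (\<Sum>i=\<Gamma>\<^sub>3 \<epsilon> + 1..\<Gamma>\<^sub>3 \<epsilon> + n. \<bar>\<alpha> (i + 1) - \<alpha> i\<bar>) \<le> \<epsilon>"
    and Q4: "\<And>\<epsilon> n. \<epsilon> > 0 \<Longrightarrow> (\<Sum>i=\<Gamma>\<^sub>4 \<epsilon> + 1..\<Gamma>\<^sub>4 \<epsilon> + n. \<bar>\<beta> (i + 1) - \<beta> i\<bar>) \<le> \<epsilon>"
    and Q5: "\<And>n. \<gamma> \<le> \<beta> n \<and> \<beta> n \<le> 1 - \<gamma>"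
    and p: "p \<in> Fix_on C T \<inter> Fix_on C U"
    and N: "0 < N" "dist (x 0) p \<le> real N" "2 * dist u p \<le> real N"
    and x_odd: "\<And>n. x (2 * n + 1) = W (T (x (2 * n))) u (\<alpha> n)"
    and x_even: "\<And>n. x (2 * n + 2) = W (U (x (2 * n + 1))) (x (2 * n + 1)) (\<beta> n)"
begin

abbreviation "\<theta>\<^sub>1 \<equiv> theta1 N \<Gamma>\<^sub>2 \<Gamma>\<^sub>3 \<Gamma>\<^sub>4"
abbreviation "\<theta>\<^sub>3 \<equiv> theta3 N \<gamma> \<Gamma>\<^sub>1 \<Gamma>\<^sub>2 \<Gamma>\<^sub>3 \<Gamma>\<^sub>4"
abbreviation "\<theta>\<^sub>4 \<equiv> theta4 N \<gamma> \<Gamma>\<^sub>1 \<Gamma>\<^sub>2 \<Gamma>\<^sub>3 \<Gamma>\<^sub>4"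
abbreviation "\<rho>\<^sub>2 \<equiv> rho2 N \<gamma> \<Gamma>\<^sub>1 \<Gamma>\<^sub>2 \<Gamma>\<^sub>3 \<Gamma>\<^sub>4"
abbreviation "\<rho>\<^sub>3 \<equiv> rho3 N \<gamma> \<Gamma>\<^sub>1 \<Gamma>\<^sub>2 \<Gamma>\<^sub>3 \<Gamma>\<^sub>4"
abbreviation "\<rho> \<equiv> rho N \<gamma> \<Gamma>\<^sub>1 \<Gamma>\<^sub>2 \<Gamma>\<^sub>3 \<Gamma>\<^sub>4"

lemma N_ge_1: "1 \<le> real N"
  using N(1) by simp

lemma \<beta>: "\<beta> n \<in> {0..1}"
  using Q5[of n] \<gamma> by auto

lemma p_fixed: "p \<in> C" "T p = p" "U p = p"
  using p by (auto simp: Fix_on_def)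

lemma T_nonexpansive: "y \<in> C \<Longrightarrow> z \<in> C \<Longrightarrow> dist (T y) (T z) \<le> dist y z"
  using T_ne by (auto simp: nonexpansive_on_def)

lemma U_nonexpansive: "y \<in> C \<Longrightarrow> z \<in> C \<Longrightarrow> dist (U y) (U z) \<le> dist y z"
  using U_ne by (auto simp: nonexpansive_on_def)

lemma W_in_C: "y \<in> C \<Longrightarrow> z \<in> C \<Longrightarrow> t \<in> {0..1} \<Longrightarrow> W y z t \<in> C"
  using convex by (auto simp: geodesically_convex_def)

lemma dist_W_le:
  assumes "t \<in> {0..1}" "dist y q \<le> r" "dist z q \<le> r"
  shows "dist (W y z t) q \<le> r"
proof -
  have "dist q (W y z t) \<le> (1 - t) * dist q y + t * dist q z" by (rule W1[OF assms(1)])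
  also have "\<dots> \<le> (1 - t) * r + t * r"
    using assms by (intro add_mono mult_left_mono) (auto simp: dist_commute)
  finally show ?thesis by (simp add: dist_commute algebra_simps)
qed

lemma T_ball: "y \<in> C \<Longrightarrow> dist y p \<le> r \<Longrightarrow> dist (T y) p \<le> r"
  using T_nonexpansive[of y p] p_fixed by simp

lemma U_ball: "y \<in> C \<Longrightarrow> dist y p \<le> r \<Longrightarrow> dist (U y) p \<le> r"
  using U_nonexpansive[of y p] p_fixed by simp

lemma iterates_in: "x n \<in> C" and iterates_bounded: "dist (x n) p \<le> real N"
proof -
  have step: "x (2 * n + 1) \<in> C \<and> dist (x (2 * n + 1)) p \<le> real N"
    if "x (2 * n) \<in> C" "dist (x (2 * n)) p \<le> real N" for n
    unfolding x_odd using that N(3) T_in u \<alpha>[of n] zero_le_dist[of u p]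
    by (intro conjI W_in_C dist_W_le T_ball) (auto simp del: zero_le_dist)
  have "x (2 * n) \<in> C \<and> dist (x (2 * n)) p \<le> real N" for n
  proof (induction n)
    case 0
    then show ?case using x0 N by simp
  next
    case (Suc n)
    then have o: "x (2 * n + 1) \<in> C" "dist (x (2 * n + 1)) p \<le> real N" using step by auto
    have "x (2 * n + 2) \<in> C \<and> dist (x (2 * n + 2)) p \<le> real N"
      unfolding x_even using o U_in \<beta>[of n] by (intro conjI W_in_C dist_W_le U_ball) auto
    then show ?case by simp
  qed
  with step have "x n \<in> C \<and> dist (x n) p \<le> real N"
    by (cases n rule: even_odd_cases) auto
  then show "x n \<in> C" "dist (x n) p \<le> real N" by auto
qed

lemma dist_in_ball: "dist y p \<le> real N \<Longrightarrow> dist z p \<le> real N \<Longrightarrow> dist y z \<le> 2 * real N"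
  using dist_triangle2[of y z p] by linarith

lemma dist_anchor: "dist y p \<le> real N \<Longrightarrow> dist y u \<le> 3 * real N / 2"
  using dist_triangle2[of y u p] N(3) by linarith

lemmas T_iterates_bounded = T_ball[OF iterates_in iterates_bounded]
lemmas U_iterates_bounded = U_ball[OF iterates_in iterates_bounded]

text \<open>
  \<open>\<Gamma>\<^sub>2\<close> bounds sums from index \<open>0\<close>; as \<open>\<alpha> \<le> 1\<close>, dropping the first \<open>m\<close> terms costs at most \<open>m\<close>.
\<close>

lemma sum_\<alpha>_lessThan_le: "(\<Sum>i<n. \<alpha> i) \<le> real n"
  using sum_mono[of "{..<n}" \<alpha> "\<lambda>_. 1"] \<alpha> by auto

lemma sum_\<alpha>_ge:
  assumes "real m + L \<le> real k" "\<Gamma>\<^sub>2 k < n" "m \<le> n"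
  shows "L \<le> (\<Sum>i=m..<n. \<alpha> i)"
proof -
  have "real k \<le> (\<Sum>i=0..\<Gamma>\<^sub>2 k. \<alpha> i)" by (rule Q2)
  also have "\<dots> \<le> (\<Sum>i<n. \<alpha> i)" using assms \<alpha> by (intro sum_mono2) auto
  also have "\<dots> = (\<Sum>i<m. \<alpha> i) + (\<Sum>i=m..<n. \<alpha> i)"
    using sum.atLeastLessThan_concat[of 0 m n \<alpha>] assms(3) by (simp add: atLeast0LessThan)
  finally show ?thesis using sum_\<alpha>_lessThan_le[of m] assms(1) by linarith
qed

lemma \<Gamma>2_ge: "k \<le> \<Gamma>\<^sub>2 k + 1"
proof -
  have "real k \<le> (\<Sum>i<\<Gamma>\<^sub>2 k + 1. \<alpha> i)" using Q2[of k] by (simp add: atLeast0AtMost lessThan_Suc_atMost)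
  then show ?thesis using sum_\<alpha>_lessThan_le[of "\<Gamma>\<^sub>2 k + 1"] by linarith
qed

text \<open>
  Each of the two half-steps is compared with the same half-step with the parameter of the next
  round: \<open>W4\<close> bounds the change of the points and \<open>W2\<close> that of the parameter. Only the Halpern half
  contracts, because its second argument is the constant \<open>u\<close>.
\<close>

lemma even_gap_step:
  "dist (x (2 * Suc n + 2)) (x (2 * Suc n))
    \<le> (1 - \<alpha> (Suc n)) * dist (x (2 * n + 2)) (x (2 * n))
      + 2 * real N * (\<bar>\<alpha> (n + 1) - \<alpha> n\<bar> + \<bar>\<beta> (n + 1) - \<beta> n\<bar>)"
proof -
  let ?o = "x (2 * n + 1)" and ?o' = "x (2 * n + 3)"
  have o': "?o' = W (T (x (2 * n + 2))) u (\<alpha> (Suc n))" using x_odd[of "Suc n"] by (simp add: eval_nat_numeral)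
  have e': "x (2 * Suc n + 2) = W (U ?o') ?o' (\<beta> (Suc n))"
    using x_even[of "Suc n"] by (simp add: eval_nat_numeral)
  have "dist (W (T (x (2 * n))) u (\<alpha> (Suc n))) ?o = \<bar>\<alpha> (n + 1) - \<alpha> n\<bar> * dist (T (x (2 * n))) u"
    using W2[OF \<alpha>[of "Suc n"] \<alpha>[of n]] unfolding x_odd by simp
  also have "\<dots> \<le> \<bar>\<alpha> (n + 1) - \<alpha> n\<bar> * (2 * real N)"
    using dist_anchor[OF T_iterates_bounded[of "2 * n"]] by (intro mult_left_mono) auto
  finally have 1: "dist (W (T (x (2 * n))) u (\<alpha> (Suc n))) ?o \<le> \<bar>\<alpha> (n + 1) - \<alpha> n\<bar> * (2 * real N)" .
  have "dist ?o' (W (T (x (2 * n))) u (\<alpha> (Suc n)))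
    \<le> (1 - \<alpha> (Suc n)) * dist (T (x (2 * n + 2))) (T (x (2 * n))) + \<alpha> (Suc n) * dist u u"
    unfolding o' by (rule W4[OF \<alpha>])
  also have "\<dots> \<le> (1 - \<alpha> (Suc n)) * dist (x (2 * n + 2)) (x (2 * n))"
    using \<alpha>[of "Suc n"] T_nonexpansive[OF iterates_in iterates_in, of "2 * n + 2" "2 * n"]
    by (simp add: mult_left_mono)
  finally have 2: "dist ?o' (W (T (x (2 * n))) u (\<alpha> (Suc n)))
    \<le> (1 - \<alpha> (Suc n)) * dist (x (2 * n + 2)) (x (2 * n))" .
  have "dist (W (U ?o) ?o (\<beta> (Suc n))) (x (2 * Suc n)) = \<bar>\<beta> (n + 1) - \<beta> n\<bar> * dist (U ?o) ?o"
    using W2[OF \<beta>[of "Suc n"] \<beta>[of n], of "U ?o" ?o] x_even[of n] by simp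
  also have "\<dots> \<le> \<bar>\<beta> (n + 1) - \<beta> n\<bar> * (2 * real N)"
    by (intro mult_left_mono dist_in_ball U_iterates_bounded iterates_bounded) auto
  finally have 3: "dist (W (U ?o) ?o (\<beta> (Suc n))) (x (2 * Suc n)) \<le> \<bar>\<beta> (n + 1) - \<beta> n\<bar> * (2 * real N)" .
  have "dist (x (2 * Suc n + 2)) (W (U ?o) ?o (\<beta> (Suc n)))
    \<le> (1 - \<beta> (Suc n)) * dist (U ?o') (U ?o) + \<beta> (Suc n) * dist ?o' ?o"
    unfolding e' by (rule W4[OF \<beta>])
  also have "\<dots> \<le> (1 - \<beta> (Suc n)) * dist ?o' ?o + \<beta> (Suc n) * dist ?o' ?o"
    using \<beta>[of "Suc n"] U_nonexpansive[OF iterates_in iterates_in]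
    by (intro add_right_mono mult_left_mono) auto
  finally have 4: "dist (x (2 * Suc n + 2)) (W (U ?o) ?o (\<beta> (Suc n))) \<le> dist ?o' ?o"
    by (simp add: algebra_simps)
  have "dist (x (2 * Suc n + 2)) (x (2 * Suc n)) \<le> dist ?o' ?o + \<bar>\<beta> (n + 1) - \<beta> n\<bar> * (2 * real N)"
    using 3 4 dist_triangle[of "x (2 * Suc n + 2)" "x (2 * Suc n)" "W (U ?o) ?o (\<beta> (Suc n))"] by linarith
  moreover have "dist ?o' ?o \<le> (1 - \<alpha> (Suc n)) * dist (x (2 * n + 2)) (x (2 * n))
      + \<bar>\<alpha> (n + 1) - \<alpha> n\<bar> * (2 * real N)"
    using 1 2 dist_triangle[of ?o' ?o "W (T (x (2 * n))) u (\<alpha> (Suc n))"] by linarith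
  ultimately show ?thesis by (simp add: algebra_simps)
qed

text \<open>
  Half of \<open>\<epsilon>\<close> is spent on the tails of the variations of \<open>\<alpha>\<close> and \<open>\<beta>\<close> beyond \<open>V\<close>, half on the
  initial value. The recursion involves \<open>\<alpha>\<close> shifted by one, so the sum of the \<open>\<alpha> i\<close> has to be
  large from \<open>V + 2\<close> on, which accounts for the summand \<open>2\<close> in \<open>\<theta>\<^sub>1\<close>.
\<close>

lemma even_gap_le:
  assumes \<epsilon>: "0 < \<epsilon>" and n: "\<theta>\<^sub>1 \<epsilon> \<le> n"
  shows "dist (x (2 * n + 2)) (x (2 * n)) \<le> \<epsilon>"
proof -
  define V where "V = V_bound N \<Gamma>\<^sub>3 \<Gamma>\<^sub>4 (\<epsilon> / 2)"
  define k where "k = V + nat \<lceil>ln (4 * real N / \<epsilon>)\<rceil> + 2"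
  define e where "e = \<epsilon> / (8 * real N)"
  have e: "0 < e" using \<epsilon> N by (simp add: e_def)
  have nk: "\<Gamma>\<^sub>2 k + 1 \<le> n" using n by (simp add: theta1_def k_def V_def)
  then have Vn: "V + 1 \<le> n" using \<Gamma>2_ge[of k] by (simp add: k_def)
  have V: "\<Gamma>\<^sub>3 e \<le> V" "\<Gamma>\<^sub>4 e \<le> V" by (simp_all add: V_def V_bound_def e_def)
  define d where "d i = 2 * real N * (\<bar>\<alpha> (i + 1) - \<alpha> i\<bar> + \<bar>\<beta> (i + 1) - \<beta> i\<bar>)" for i
  have "dist (x (2 * n + 2)) (x (2 * n))
    \<le> exp (- (\<Sum>i=V + 1..<n. \<alpha> (Suc i))) * (2 * real N) + 0 + (\<Sum>i=V + 1..<n. d i)"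
    using Vn \<alpha> even_gap_step
    by (intro halpern_recursion_bound[where a="\<lambda>n. dist (x (2 * n + 2)) (x (2 * n))"])
      (auto simp: d_def dist_in_ball iterates_bounded)
  moreover have "(\<Sum>i=V + 1..<n. d i) \<le> \<epsilon> / 2"
  proof -
    have "(\<Sum>i=V + 1..<n. \<bar>\<alpha> (i + 1) - \<alpha> i\<bar>) \<le> e" "(\<Sum>i=V + 1..<n. \<bar>\<beta> (i + 1) - \<beta> i\<bar>) \<le> e"
      using sum_tail_le[OF Q3[OF e] _ V(1)] sum_tail_le[OF Q4[OF e] _ V(2)] by auto
    then have "(\<Sum>i=V + 1..<n. d i) \<le> 2 * real N * (e + e)"
      unfolding d_def sum_distrib_left[symmetric] sum.distrib
      by (intro mult_left_mono add_mono) auto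
    then show ?thesis using N by (simp add: e_def)
  qed
  moreover have "exp (- (\<Sum>i=V + 1..<n. \<alpha> (Suc i))) * (2 * real N) \<le> \<epsilon> / 2"
  proof -
    have "ln (4 * real N / \<epsilon>) \<le> (\<Sum>i=V + 2..<n + 1. \<alpha> i)"
      using nk Vn by (intro sum_\<alpha>_ge[of _ _ k]) (auto simp: k_def of_nat_ceiling)
    also have "\<dots> = (\<Sum>i=V + 1..<n. \<alpha> (Suc i))"
      using sum.shift_bounds_Suc_ivl[of \<alpha> "V + 1" n] by simp
    finally have "exp (- (\<Sum>i=V + 1..<n. \<alpha> (Suc i))) \<le> exp (- ln (4 * real N / \<epsilon>))" by simp
    also have "\<dots> = \<epsilon> / (4 * real N)" using \<epsilon> N by (simp add: exp_minus)
    finally show ?thesis using N by (simp add: field_simps)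
  qed
  ultimately show ?thesis by linarith
qed

text \<open>
  The Mann step decreases the squared distance to \<open>p\<close> by at least \<open>\<gamma>\<^sup>2\<close> times the squared residual.
  This decrease is small, since the Halpern step adds at most a multiple of \<open>\<alpha> n\<close> and the
  two even iterates around it are close.
\<close>

lemma U_odd_residual_le:
  assumes \<epsilon>: "0 < \<epsilon>" and n: "\<theta>\<^sub>3 \<epsilon> \<le> n"
  shows "dist (U (x (2 * n + 1))) (x (2 * n + 1)) \<le> \<epsilon>"
proof -
  let ?o = "x (2 * n + 1)" and ?e = "x (2 * n)" and ?e' = "x (2 * n + 2)"
  define c where "c = (\<gamma> * \<epsilon>)\<^sup>2"
  have c: "0 < c" using \<gamma> \<epsilon> by (simp add: c_def)
  have gap: "dist ?e ?e' \<le> c / (8 * real N)" using even_gap_le[of "c / (8 * real N)" n] c N n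
    by (simp add: theta3_def c_def dist_commute)
  have \<alpha>n: "\<alpha> n \<le> c / (2 * (real N)\<^sup>2)" using Q1[of "c / (2 * (real N)\<^sup>2)" n] c N n
    by (simp add: theta3_def c_def)
  have "(dist p ?e')\<^sup>2 \<le> (1 - \<beta> n) * (dist p (U ?o))\<^sup>2 + \<beta> n * (dist p ?o)\<^sup>2
      - \<beta> n * (1 - \<beta> n) * (dist (U ?o) ?o)\<^sup>2"
    unfolding x_even by (rule CN_inequality[OF \<beta>])
  also have "\<dots> \<le> (1 - \<beta> n) * (dist p ?o)\<^sup>2 + \<beta> n * (dist p ?o)\<^sup>2 - \<gamma> * \<gamma> * (dist (U ?o) ?o)\<^sup>2"
    using \<beta>[of n] Q5[of n] \<gamma> U_ball[OF iterates_in order_refl, of "2 * n + 1"]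
    by (intro diff_mono add_mono mult_left_mono mult_right_mono mult_mono power_mono)
      (auto simp: dist_commute)
  finally have "\<gamma>\<^sup>2 * (dist (U ?o) ?o)\<^sup>2 \<le> (dist ?o p)\<^sup>2 - (dist ?e' p)\<^sup>2"
    by (simp add: algebra_simps power2_eq_square dist_commute)
  moreover have up: "dist u p \<le> real N" using N(3) zero_le_dist[of u p] by linarith
  have "(dist ?o p)\<^sup>2 \<le> (dist ?e p)\<^sup>2 + c / 2"
  proof -
    have "(dist p ?o)\<^sup>2 \<le> (1 - \<alpha> n) * (dist p (T ?e))\<^sup>2 + \<alpha> n * (dist p u)\<^sup>2
        - \<alpha> n * (1 - \<alpha> n) * (dist (T ?e) u)\<^sup>2"
      unfolding x_odd by (rule CN_inequality[OF \<alpha>])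
    also have "\<dots> \<le> 1 * (dist ?e p)\<^sup>2 + c / (2 * (real N)\<^sup>2) * (real N)\<^sup>2 - 0"
      using \<alpha>[of n] \<alpha>n c up T_ball[OF iterates_in order_refl, of "2 * n"]
      by (intro diff_mono add_mono mult_mono power_mono) (auto simp: dist_commute)
    finally show ?thesis using N by (simp add: dist_commute)
  qed
  moreover have "(dist ?e p)\<^sup>2 - (dist ?e' p)\<^sup>2 \<le> 2 * real N * (c / (8 * real N))"
    using dist_square_diff_le[OF iterates_bounded iterates_bounded, of "2 * n" "2 * n + 2"]
      mult_left_mono[OF gap, of "2 * real N"] by simp
  moreover have "2 * real N * (c / (8 * real N)) = c / 4" using N by simp
  ultimately have "\<gamma>\<^sup>2 * (dist (U ?o) ?o)\<^sup>2 \<le> c" using c by linarith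
  then have "(dist (U ?o) ?o)\<^sup>2 \<le> \<epsilon>\<^sup>2" using \<gamma> by (simp add: c_def power_mult_distrib)
  then show ?thesis using \<epsilon> by (meson power2_le_imp_le less_imp_le)
qed

lemma odd_even_gap_le:
  assumes "0 < \<epsilon>" "\<theta>\<^sub>3 \<epsilon> \<le> n"
  shows "dist (x (2 * n + 2)) (x (2 * n + 1)) \<le> \<epsilon>"
proof -
  have "dist (x (2 * n + 2)) (x (2 * n + 1)) = (1 - \<beta> n) * dist (U (x (2 * n + 1))) (x (2 * n + 1))"
    unfolding x_even by (rule dist_W_right[OF \<beta>])
  also have "\<dots> \<le> dist (U (x (2 * n + 1))) (x (2 * n + 1))"
    using \<beta>[of n] by (intro mult_left_le_one_le) auto
  finally show ?thesis using U_odd_residual_le[OF assms] by linarith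
qed

lemma even_odd_gap_le:
  assumes "0 < \<epsilon>" "\<theta>\<^sub>4 \<epsilon> \<le> n"
  shows "dist (x (2 * n + 1)) (x (2 * n)) \<le> \<epsilon>"
  using even_gap_le[of "\<epsilon> / 2" n] odd_even_gap_le[of "\<epsilon> / 2" n] assms
    dist_triangle3[of "x (2 * n + 1)" "x (2 * n)" "x (2 * n + 2)"]
  by (simp add: theta4_def)

lemma U_residual_le:
  assumes \<epsilon>: "0 < \<epsilon>" and n: "\<rho>\<^sub>2 \<epsilon> \<le> n"
  shows "dist (U (x n)) (x n) \<le> \<epsilon>"
proof (cases n rule: even_odd_cases)
  case (odd k)
  then show ?thesis using U_odd_residual_le[of "\<epsilon> / 3" k] assms by (simp add: rho2_def)
next
  case (even k)
  then obtain j where j: "n = 2 * j + 2" using n by (cases k) (auto simp: rho2_def)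
  let ?e = "x (2 * j + 2)" and ?o = "x (2 * j + 1)"
  have "\<theta>\<^sub>3 (\<epsilon> / 3) \<le> j" using n j by (simp add: rho2_def)
  then have "dist (U ?o) ?o \<le> \<epsilon> / 3" "dist ?e ?o \<le> \<epsilon> / 3"
    using U_odd_residual_le[of "\<epsilon> / 3" j] odd_even_gap_le[of "\<epsilon> / 3" j] \<epsilon> by auto
  moreover have "dist (U ?e) (U ?o) \<le> dist ?e ?o" by (intro U_nonexpansive iterates_in)
  ultimately show ?thesis
    using dist_triangle[of "U ?e" ?e "U ?o"] dist_triangle2[of "U ?o" ?e ?o] unfolding j by linarith
qed

text \<open>
  A Halpern step moves \<open>T (x (2 * n))\<close> by a multiple of \<open>\<alpha> n\<close> only, so \<open>x (2 * n + 1)\<close> is close both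
  to its predecessor and to the image of its predecessor.
\<close>

lemma T_residual_le:
  assumes \<epsilon>: "0 < \<epsilon>" and n: "\<rho>\<^sub>3 \<epsilon> \<le> n"
  shows "dist (T (x n)) (x n) \<le> \<epsilon>"
proof -
  have gap: "dist (x (2 * k + 1)) (x (2 * k)) \<le> \<epsilon> / 6"
    and res: "dist (T (x (2 * k))) (x (2 * k + 1)) \<le> 3 * \<epsilon> / 8"
    if k: "max (\<theta>\<^sub>4 (\<epsilon> / 6)) (\<Gamma>\<^sub>1 (\<epsilon> / (4 * real N))) \<le> k" for k
  proof -
    show "dist (x (2 * k + 1)) (x (2 * k)) \<le> \<epsilon> / 6" using even_odd_gap_le[of "\<epsilon> / 6" k] \<epsilon> k by simp
    have "dist (T (x (2 * k))) (x (2 * k + 1)) = \<alpha> k * dist (T (x (2 * k))) u"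
      unfolding x_odd using dist_W_left[OF \<alpha>] by (simp add: dist_commute)
    also have "\<dots> \<le> \<epsilon> / (4 * real N) * (3 * real N / 2)"
      using Q1[of "\<epsilon> / (4 * real N)" k] k \<epsilon> N \<alpha>[of k] dist_anchor[OF T_iterates_bounded[of "2 * k"]]
      by (intro mult_mono) auto
    also have "\<dots> = 3 * \<epsilon> / 8" using N by simp
    finally show "dist (T (x (2 * k))) (x (2 * k + 1)) \<le> 3 * \<epsilon> / 8" .
  qed
  show ?thesis
  proof (cases n rule: even_odd_cases)
    case (even k)
    then have "max (\<theta>\<^sub>4 (\<epsilon> / 6)) (\<Gamma>\<^sub>1 (\<epsilon> / (4 * real N))) \<le> k" using n by (auto simp: rho3_def)
    from gap[OF this] res[OF this] show ?thesis
      using dist_triangle[of "T (x (2 * k))" "x (2 * k)" "x (2 * k + 1)"] \<epsilon> even by simp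
  next
    case (odd k)
    then have "max (\<theta>\<^sub>4 (\<epsilon> / 6)) (\<Gamma>\<^sub>1 (\<epsilon> / (4 * real N))) \<le> k" using n by (auto simp: rho3_def)
    from gap[OF this] res[OF this] show ?thesis
      using dist_triangle[of "T (x (2 * k + 1))" "x (2 * k + 1)" "T (x (2 * k))"]
        T_nonexpansive[OF iterates_in iterates_in, of "2 * k + 1" "2 * k"] \<epsilon> odd by simp
  qed
qed

section \<open>Monotonicity of the rates\<close>

lemma \<Gamma>_antitone:
  assumes "0 < a" "a \<le> b"
  shows "\<Gamma>\<^sub>1 b \<le> \<Gamma>\<^sub>1 a" "\<Gamma>\<^sub>3 b \<le> \<Gamma>\<^sub>3 a" "\<Gamma>\<^sub>4 b \<le> \<Gamma>\<^sub>4 a"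
  using \<Gamma>1 \<Gamma>3 \<Gamma>4 assms by (auto simp: monotone_on_def)

lemma theta1_antitone:
  assumes "0 < a" "a \<le> b"
  shows "\<theta>\<^sub>1 b \<le> \<theta>\<^sub>1 a"
proof -
  have "V_bound N \<Gamma>\<^sub>3 \<Gamma>\<^sub>4 (b / 2) \<le> V_bound N \<Gamma>\<^sub>3 \<Gamma>\<^sub>4 (a / 2)"
    unfolding V_bound_def using assms N
    by (intro max.mono \<Gamma>_antitone) (auto simp: divide_right_mono)
  moreover have "ln (4 * real N / b) \<le> ln (4 * real N / a)"
    using assms N by (simp add: frac_le)
  ultimately show ?thesis
    unfolding theta1_def by (intro add_mono monoD[OF \<Gamma>2] nat_mono ceiling_mono) auto
qed

lemma theta3_antitone:
  assumes "0 < a" "a \<le> b"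
  shows "\<theta>\<^sub>3 b \<le> \<theta>\<^sub>3 a"
proof -
  have "(\<gamma> * a)\<^sup>2 \<le> (\<gamma> * b)\<^sup>2" using assms \<gamma> by (intro power_mono mult_left_mono) auto
  then show ?thesis
    unfolding theta3_def using assms N \<gamma>
    by (intro max.mono theta1_antitone \<Gamma>_antitone) (auto simp: divide_right_mono)
qed

lemma rho_antitone:
  assumes "0 < a" "a \<le> b"
  shows "\<rho> b \<le> \<rho> a"
proof -
  have scale: "0 < a / r" "a / r \<le> b / r" if "0 < r" for r
    using assms that by (auto simp: divide_right_mono)
  have 1: "\<theta>\<^sub>3 (b / 3) \<le> \<theta>\<^sub>3 (a / 3)" by (intro theta3_antitone scale) simp_all
  have 2: "\<theta>\<^sub>1 (b / 6 / 2) \<le> \<theta>\<^sub>1 (a / 6 / 2)" "\<theta>\<^sub>3 (b / 6 / 2) \<le> \<theta>\<^sub>3 (a / 6 / 2)"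
    using theta1_antitone[OF scale, of 12] theta3_antitone[OF scale, of 12] by simp_all
  have 3: "\<Gamma>\<^sub>1 (b / (4 * real N)) \<le> \<Gamma>\<^sub>1 (a / (4 * real N))"
    using N by (intro \<Gamma>_antitone scale) simp_all
  show ?thesis
    unfolding rho_def rho2_def rho3_def theta4_def using 1 max.mono[OF max.mono[OF 2] 3]
    by (intro max.mono) simp_all
qed

section \<open>Approximate projection of the anchor\<close>

text \<open>
  The restriction to the ball around \<open>p\<close> makes all distances between these points bounded by \<open>2N\<close>.
  It holds for all iterates and is preserved along geodesics.
\<close>

definition approx_common_fix :: "real \<Rightarrow> 'a set" where
  "approx_common_fix \<eta> =
    {y \<in> C. dist y p \<le> real N \<and> dist (T y) y \<le> \<eta> \<and> dist (U y) y \<le> \<eta>}"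

lemma p_approx_common_fix: "0 < \<eta> \<Longrightarrow> p \<in> approx_common_fix \<eta>"
  using p_fixed by (simp add: approx_common_fix_def)

lemma approx_common_fix_mono: "\<eta> \<le> \<eta>' \<Longrightarrow> approx_common_fix \<eta> \<subseteq> approx_common_fix \<eta>'"
  by (auto simp: approx_common_fix_def)

lemma approx_common_fix_geodesic:
  assumes \<xi>: "0 < \<xi>" "\<xi> \<le> 1" and t: "t \<in> {0..1}"
    and y: "y \<in> approx_common_fix (\<xi>\<^sup>2 / (24 * real N))"
    and z: "z \<in> approx_common_fix (\<xi>\<^sup>2 / (24 * real N))"
  shows "W y z t \<in> approx_common_fix \<xi>"
proof -
  define \<eta> where "\<eta> = \<xi>\<^sup>2 / (24 * real N)"
  have yz: "y \<in> C" "z \<in> C" "dist y p \<le> real N" "dist z p \<le> real N"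
    "dist (T y) y \<le> \<eta>" "dist (T z) z \<le> \<eta>" "dist (U y) y \<le> \<eta>" "dist (U z) z \<le> \<eta>"
    using y z by (auto simp: approx_common_fix_def \<eta>_def)
  have \<eta>0: "0 < \<eta>" using \<xi> N by (simp add: \<eta>_def)
  have N\<eta>: "real N * \<eta> = \<xi>\<^sup>2 / 24" using N by (simp add: \<eta>_def)
  have \<eta>1: "\<eta> \<le> 1"
  proof -
    have "\<xi>\<^sup>2 \<le> 1" using \<xi> by (simp add: power_le_one)
    then have "1 * \<eta> \<le> 1" using mult_right_mono[OF N_ge_1, of \<eta>] N\<eta> \<eta>0 by linarith
    then show ?thesis by simp
  qed
  have "\<eta> * dist y z + \<eta>\<^sup>2 \<le> \<eta> * (2 * real N) + \<eta> * real N"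
    unfolding power2_eq_square using dist_in_ball[OF yz(3,4)] \<eta>0 \<eta>1 N_ge_1
    by (intro add_mono mult_left_mono) auto
  also have "\<dots> = 3 * (real N * \<eta>)" by simp
  also have "\<dots> \<le> \<xi>\<^sup>2" unfolding N\<eta> using zero_le_power2[of \<xi>] by linarith
  finally have le: "\<eta> * dist y z + \<eta>\<^sup>2 \<le> \<xi>\<^sup>2" .
  have "dist (T (W y z t)) (W y z t) \<le> \<xi>"
    using approx_fixed_point_on_geodesic[OF T_ne convex yz(1,2) t yz(5,6)] le \<xi>(1)
    by (meson order_trans power2_le_imp_le less_imp_le)
  moreover have "dist (U (W y z t)) (W y z t) \<le> \<xi>"
    using approx_fixed_point_on_geodesic[OF U_ne convex yz(1,2) t yz(7,8)] le \<xi>(1)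
    by (meson order_trans power2_le_imp_le less_imp_le)
  ultimately show ?thesis
    using W_in_C[OF yz(1,2) t] dist_W_le[OF t yz(3,4)] by (simp add: approx_common_fix_def)
qed

text \<open>
  The function \<open>delta_tilde\<close> asks two things of the near-minimiser \<open>z\<close> for accuracy \<open>\<xi>\<close>: the accuracy
  \<open>\<delta> \<eta>\<close> that is wanted in the end, with \<open>\<eta> = \<xi>\<^sup>2 / (24 N)\<close>, and the accuracy \<open>\<eta>\<close>, by which geodesics
  from \<open>z\<close> to points of accuracy \<open>\<eta>\<close> stay among the points of accuracy \<open>\<xi>\<close> to which the
  minimality refers.
\<close>

lemma approx_projection:
  assumes \<epsilon>: "0 < \<epsilon>" and \<delta>: "\<And>\<eta>. 0 < \<eta> \<Longrightarrow> \<eta> \<le> 1 \<Longrightarrow> 0 < \<delta> \<eta> \<and> \<delta> \<eta> \<le> 1"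
  obtains \<eta> z where "0 < \<eta>" "\<eta> \<le> 1" "0 < Phi_big N \<epsilon> \<delta>" "Phi_big N \<epsilon> \<delta> \<le> \<eta>"
    "z \<in> approx_common_fix (\<delta> \<eta>)"
    "\<And>y. y \<in> approx_common_fix \<eta> \<Longrightarrow> (dist u z)\<^sup>2 + (dist z y)\<^sup>2 - (dist u y)\<^sup>2 \<le> 2 * \<epsilon>"
proof -
  define d where "d = delta_tilde N \<delta>"
  define \<epsilon>' where "\<epsilon>' = \<epsilon>\<^sup>2 / (4 * (real N)\<^sup>2)"
  have \<epsilon>': "0 < \<epsilon>'" using \<epsilon> N by (simp add: \<epsilon>'_def)
  have sq: "0 < \<xi>\<^sup>2 / (24 * real N) \<and> \<xi>\<^sup>2 / (24 * real N) \<le> 1" if "0 < \<xi>" "\<xi> \<le> 1" for \<xi> :: real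
  proof -
    have "\<xi>\<^sup>2 \<le> 1" using that by (simp add: power_le_one)
    then have "\<xi>\<^sup>2 \<le> 24 * real N" using N_ge_1 by linarith
    then show ?thesis using that N by simp
  qed
  have d: "0 < d \<xi> \<and> d \<xi> \<le> 1" if "0 < \<xi>" "\<xi> \<le> 1" for \<xi>
    using sq[OF that] \<delta>[of "\<xi>\<^sup>2 / (24 * real N)"] by (auto simp: d_def delta_tilde_def)
  have it: "0 < (d ^^ i) 1 \<and> (d ^^ i) 1 \<le> 1" for i
    by (induction i) (auto simp: d)
  have up: "(dist u p)\<^sup>2 \<le> (real N)\<^sup>2 / 4"
    using power_mono[of "2 * dist u p" "real N" 2] N(3) by (simp add: power_mult_distrib)
  have "\<exists>i\<le>nat \<lceil>(real N)\<^sup>2 / 4 / \<epsilon>'\<rceil>. \<exists>z\<in>approx_common_fix (d ((d ^^ i) 1)).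
      \<forall>y\<in>approx_common_fix ((d ^^ i) 1). (dist u z)\<^sup>2 \<le> (dist u y)\<^sup>2 + \<epsilon>'"
    using \<epsilon>' up it by (intro approx_minimizer[where p=p]) (auto intro: p_approx_common_fix)
  then obtain i z where i: "i \<le> nat \<lceil>(real N)\<^sup>2 / (4 * \<epsilon>')\<rceil>"
    and z: "z \<in> approx_common_fix (d ((d ^^ i) 1))"
    and min: "\<And>y. y \<in> approx_common_fix ((d ^^ i) 1) \<Longrightarrow> (dist u z)\<^sup>2 \<le> (dist u y)\<^sup>2 + \<epsilon>'"
    by auto
  define \<xi> where "\<xi> = (d ^^ i) 1"
  define \<eta> where "\<eta> = \<xi>\<^sup>2 / (24 * real N)"
  have \<xi>: "0 < \<xi>" "\<xi> \<le> 1" using it by (auto simp: \<xi>_def)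
  have \<eta>: "0 < \<eta>" "\<eta> \<le> 1" using sq[OF \<xi>] by (auto simp: \<eta>_def)
  have "phi_small N \<epsilon>' d \<le> \<xi>" unfolding phi_small_def \<xi>_def using i by (intro Min_le) auto
  moreover have phi: "0 < phi_small N \<epsilon>' d" unfolding phi_small_def using it by simp
  ultimately have "(phi_small N \<epsilon>' d)\<^sup>2 \<le> \<xi>\<^sup>2" by (intro power_mono) auto
  then have "Phi_big N \<epsilon> \<delta> \<le> \<eta>"
    by (simp add: Phi_big_def \<eta>_def d_def \<epsilon>'_def divide_right_mono)
  moreover have "0 < Phi_big N \<epsilon> \<delta>" using phi N by (simp add: Phi_big_def d_def \<epsilon>'_def)
  moreover have "d \<xi> \<le> \<delta> \<eta>" "d \<xi> \<le> \<eta>" by (auto simp: d_def delta_tilde_def \<eta>_def)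
  with z have z1: "z \<in> approx_common_fix (\<delta> \<eta>)" and z2: "z \<in> approx_common_fix \<eta>"
    using approx_common_fix_mono unfolding \<xi>_def by blast+
  moreover have "(dist u z)\<^sup>2 + (dist z y)\<^sup>2 - (dist u y)\<^sup>2 \<le> 2 * \<epsilon>"
    if y: "y \<in> approx_common_fix \<eta>" for y
  proof (rule variational_inequality[where R="2 * real N"])
    have "dist z p \<le> real N" "dist y p \<le> real N" using y z1 by (auto simp: approx_common_fix_def)
    then show "dist u z \<le> 2 * real N" "dist z y \<le> 2 * real N"
      using dist_anchor[of z] dist_in_ball[of z y] by (auto simp: dist_commute)
    fix t :: real assume "t \<in> {0..1}"
    then have "W z y t \<in> approx_common_fix \<xi>"
      using approx_common_fix_geodesic[OF \<xi>] z2 y by (simp add: \<eta>_def)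
    then show "(dist u z)\<^sup>2 \<le> (dist u (W z y t))\<^sup>2 + \<epsilon>\<^sup>2 / (2 * real N)\<^sup>2"
      using min[of "W z y t"] by (simp add: \<xi>_def \<epsilon>'_def power_mult_distrib)
  qed (use \<epsilon> N in auto)
  ultimately show ?thesis using \<eta> that by blast
qed

text \<open>
  From the index \<open>\<rho> \<eta>\<close> on, the iterates are approximate common fixed points of accuracy \<open>\<eta>\<close>, so an
  accuracy can be demanded in terms of an index instead of \<open>\<eta>\<close>; as \<open>\<rho>\<close> is antitone, a lower
  bound for \<open>\<eta>\<close> bounds the index from above.
\<close>

lemma approx_projection_iterates:
  assumes \<epsilon>: "0 < \<epsilon>" and \<Delta>: "\<And>n. 0 < \<Delta> n \<and> \<Delta> n \<le> 1"
  obtains n z where "n \<le> Psi_bound N \<gamma> \<Gamma>\<^sub>1 \<Gamma>\<^sub>2 \<Gamma>\<^sub>3 \<Gamma>\<^sub>4 \<epsilon> \<Delta>" "z \<in> approx_common_fix (\<Delta> n)"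
    "\<And>m. n \<le> m \<Longrightarrow> (dist u z)\<^sup>2 + (dist z (x m))\<^sup>2 - (dist u (x m))\<^sup>2 \<le> 2 * \<epsilon>"
proof -
  obtain \<eta> z where \<eta>: "0 < \<eta>" "\<eta> \<le> 1" and \<Phi>: "0 < Phi_big N \<epsilon> (\<lambda>\<eta>. \<Delta> (\<rho> \<eta>))" "Phi_big N \<epsilon> (\<lambda>\<eta>. \<Delta> (\<rho> \<eta>)) \<le> \<eta>"
    and z: "z \<in> approx_common_fix (\<Delta> (\<rho> \<eta>))"
    and var: "\<And>y. y \<in> approx_common_fix \<eta> \<Longrightarrow> (dist u z)\<^sup>2 + (dist z y)\<^sup>2 - (dist u y)\<^sup>2 \<le> 2 * \<epsilon>"
    by (rule approx_projection[OF \<epsilon>, of "\<lambda>\<eta>. \<Delta> (\<rho> \<eta>)"]) (use \<Delta> that in simp_all)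
  show ?thesis
  proof (rule that)
    show "\<rho> \<eta> \<le> Psi_bound N \<gamma> \<Gamma>\<^sub>1 \<Gamma>\<^sub>2 \<Gamma>\<^sub>3 \<Gamma>\<^sub>4 \<epsilon> \<Delta>"
      unfolding Psi_bound_def by (rule rho_antitone[OF \<Phi>])
    show "z \<in> approx_common_fix (\<Delta> (\<rho> \<eta>))" by (rule z)
    fix m assume "\<rho> \<eta> \<le> m"
    then have "x m \<in> approx_common_fix \<eta>"
      using T_residual_le[OF \<eta>(1)] U_residual_le[OF \<eta>(1)] iterates_in iterates_bounded
      by (simp add: approx_common_fix_def rho_def)
    then show "(dist u z)\<^sup>2 + (dist z (x m))\<^sup>2 - (dist u (x m))\<^sup>2 \<le> 2 * \<epsilon>" by (rule var)
  qed
qed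

section \<open>Metastability\<close>

lemma square_add_le:
  assumes "0 \<le> a" "a \<le> b + \<delta>" "0 \<le> b" "b \<le> 2 * real N" "0 \<le> \<delta>" "\<delta> \<le> 1"
  shows "a\<^sup>2 \<le> b\<^sup>2 + 5 * real N * \<delta>"
proof -
  have "a\<^sup>2 \<le> (b + \<delta>)\<^sup>2" using assms by (intro power_mono) auto
  also have "\<dots> = b\<^sup>2 + (2 * b + \<delta>) * \<delta>" by (simp add: power2_eq_square algebra_simps)
  also have "\<dots> \<le> b\<^sup>2 + (5 * real N) * \<delta>"
    using assms N_ge_1 by (intro add_left_mono mult_right_mono) auto
  finally show ?thesis .
qed

text \<open>
  The inequality for the Halpern step yields the coefficient
  \<open>d(u,z)\<^sup>2 - (1 - \<alpha>\<^sub>m) d(T x\<^bsub>2m\<^esub>, u)\<^sup>2\<close> of \<open>\<alpha>\<^sub>m\<close>. It is small because \<open>T x\<^bsub>2m\<^esub>\<close> may be replaced by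
  \<open>x\<^bsub>2m\<^esub>\<close> by asymptotic regularity and \<open>\<alpha>\<^sub>m\<close> is small, so that the variational inequality applies.
  The errors \<open>\<epsilon> / 12\<close>, \<open>\<epsilon> / 64\<close> and \<open>\<epsilon> / 12\<close> of these three steps stay below \<open>\<epsilon> / 3\<close>. Moving the maps
  \<open>T\<close> and \<open>U\<close> past \<open>z\<close> costs \<open>5 N \<delta>\<close> each.
\<close>

lemma dist_approx_fix_step:
  assumes z: "z \<in> approx_common_fix \<delta>" and \<delta>: "0 \<le> \<delta>" "\<delta> \<le> 1" and \<epsilon>: "0 < \<epsilon>"
    and m: "\<rho>\<^sub>3 (\<epsilon> / (36 * real N)) \<le> m"
    and var: "(dist u z)\<^sup>2 + (dist z (x (2 * m)))\<^sup>2 - (dist u (x (2 * m)))\<^sup>2 \<le> \<epsilon> / 12"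
  shows "(dist (x (2 * Suc m)) z)\<^sup>2
    \<le> (1 - \<alpha> m) * (dist (x (2 * m)) z)\<^sup>2 + \<alpha> m * (\<epsilon> / 3) + 10 * real N * \<delta>"
proof -
  let ?e = "x (2 * m)" and ?o = "x (2 * m + 1)" and ?e' = "x (2 * m + 2)"
  have zC: "z \<in> C" and zp: "dist z p \<le> real N" and Tz: "dist (T z) z \<le> \<delta>" and Uz: "dist (U z) z \<le> \<delta>"
    using z by (auto simp: approx_common_fix_def)
  have bd: "dist (x k) z \<le> 2 * real N" for k by (rule dist_in_ball[OF iterates_bounded zp])
  \<comment> \<open>\<open>\<rho>\<^sub>3\<close> contains the value of \<open>\<Gamma>\<^sub>1\<close> needed here.\<close>
  have \<alpha>m: "\<alpha> m \<le> \<epsilon> / (144 * (real N)\<^sup>2)"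
  proof -
    have "\<epsilon> / (36 * real N) / (4 * real N) = \<epsilon> / (144 * (real N)\<^sup>2)" by (simp add: power2_eq_square)
    then show ?thesis using Q1[of "\<epsilon> / (144 * (real N)\<^sup>2)" m] m \<epsilon> N by (simp add: rho3_def)
  qed
  have Te: "dist ?e (T ?e) \<le> \<epsilon> / (36 * real N)"
    using T_residual_le[of "\<epsilon> / (36 * real N)" "2 * m"] m \<epsilon> N by (simp add: dist_commute)
  have U_step: "(dist ?e' z)\<^sup>2 \<le> (dist ?o z)\<^sup>2 + 5 * real N * \<delta>"
  proof (rule square_add_le)
    have "dist (U ?o) z \<le> dist ?o z + \<delta>"
      using dist_triangle[of "U ?o" z "U z"] U_nonexpansive[OF iterates_in zC] Uz
      by (smt (verit))
    then show "dist ?e' z \<le> dist ?o z + \<delta>"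
      unfolding x_even using \<delta> by (intro dist_W_le[OF \<beta>]) auto
  qed (use bd \<delta> in auto)
  have T_step: "(dist (T ?e) z)\<^sup>2 \<le> (dist ?e z)\<^sup>2 + 5 * real N * \<delta>"
  proof (rule square_add_le)
    show "dist (T ?e) z \<le> dist ?e z + \<delta>"
      using dist_triangle[of "T ?e" z "T z"] T_nonexpansive[OF iterates_in zC, of "2 * m"] Tz by linarith
  qed (use bd \<delta> in auto)
  have anchor: "(dist u z)\<^sup>2 - (1 - \<alpha> m) * (dist (T ?e) u)\<^sup>2 \<le> \<epsilon> / 3"
  proof -
    have "(dist ?e u)\<^sup>2 - (dist (T ?e) u)\<^sup>2 \<le> 2 * (3 * real N / 2) * dist ?e (T ?e)"
      by (intro dist_square_diff_le dist_anchor iterates_bounded T_iterates_bounded)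
    also have "\<dots> \<le> 2 * (3 * real N / 2) * (\<epsilon> / (36 * real N))"
      using Te by (intro mult_left_mono) auto
    also have "\<dots> = \<epsilon> / 12" using N by simp
    finally have 1: "(dist ?e u)\<^sup>2 - (dist (T ?e) u)\<^sup>2 \<le> \<epsilon> / 12" .
    have "\<alpha> m * (dist (T ?e) u)\<^sup>2 \<le> \<epsilon> / (144 * (real N)\<^sup>2) * (3 * real N / 2)\<^sup>2"
      using \<alpha>m \<alpha>[of m] dist_anchor[OF T_iterates_bounded, of "2 * m"] \<epsilon>
      by (intro mult_mono power_mono) auto
    also have "\<dots> = \<epsilon> / 64" using N by (simp add: power2_eq_square)
    finally have 2: "\<alpha> m * (dist (T ?e) u)\<^sup>2 \<le> \<epsilon> / 64" .
    have "(dist u z)\<^sup>2 - (1 - \<alpha> m) * (dist (T ?e) u)\<^sup>2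
      = ((dist u z)\<^sup>2 - (dist ?e u)\<^sup>2) + ((dist ?e u)\<^sup>2 - (dist (T ?e) u)\<^sup>2) + \<alpha> m * (dist (T ?e) u)\<^sup>2"
      by (simp add: algebra_simps)
    moreover have "(dist u z)\<^sup>2 - (dist ?e u)\<^sup>2 \<le> \<epsilon> / 12"
      using var zero_le_power2[of "dist z ?e"] unfolding dist_commute[of ?e u] by linarith
    ultimately show ?thesis using 1 2 \<epsilon> by linarith
  qed
  have "(dist z ?o)\<^sup>2 \<le> (1 - \<alpha> m) * (dist z (T ?e))\<^sup>2 + \<alpha> m * (dist z u)\<^sup>2
      - \<alpha> m * (1 - \<alpha> m) * (dist (T ?e) u)\<^sup>2"
    unfolding x_odd by (rule CN_inequality[OF \<alpha>])
  also have "\<dots> = (1 - \<alpha> m) * (dist (T ?e) z)\<^sup>2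
      + \<alpha> m * ((dist u z)\<^sup>2 - (1 - \<alpha> m) * (dist (T ?e) u)\<^sup>2)"
    by (simp add: algebra_simps dist_commute)
  also have "\<dots> \<le> (1 - \<alpha> m) * ((dist ?e z)\<^sup>2 + 5 * real N * \<delta>) + \<alpha> m * (\<epsilon> / 3)"
    using \<alpha>[of m] T_step anchor by (intro add_mono mult_left_mono) auto
  also have "\<dots> \<le> (1 - \<alpha> m) * (dist ?e z)\<^sup>2 + \<alpha> m * (\<epsilon> / 3) + 5 * real N * \<delta>"
    using mult_left_le_one_le[of "5 * real N * \<delta>" "1 - \<alpha> m"] \<alpha>[of m] \<delta>
    by (simp add: ring_distribs)
  finally show ?thesis using U_step by (simp add: dist_commute)
qed

text \<open>
  A third of \<open>\<epsilon>\<close> each is left for the initial value, the coefficient of \<open>\<alpha>\<^sub>m\<close> in the recursion, and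
  the sum of the errors of the at most \<open>m\<close> steps.
\<close>

lemma dist_approx_fix_le:
  assumes z: "z \<in> approx_common_fix \<delta>" and \<delta>: "0 \<le> \<delta>" "\<delta> \<le> 1" and \<epsilon>: "0 < \<epsilon>"
    and K: "\<rho>\<^sub>3 (\<epsilon> / (36 * real N)) \<le> K"
    and var: "\<And>m. K \<le> m \<Longrightarrow> (dist u z)\<^sup>2 + (dist z (x (2 * m)))\<^sup>2 - (dist u (x (2 * m)))\<^sup>2 \<le> \<epsilon> / 12"
    and m: "\<Gamma>\<^sub>2 (K + nat \<lceil>ln (12 * (real N)\<^sup>2 / \<epsilon>)\<rceil>) + 1 \<le> m"
    and m\<delta>: "real m * (10 * real N * \<delta>) \<le> \<epsilon> / 3"
  shows "(dist (x (2 * m)) z)\<^sup>2 \<le> \<epsilon>"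
proof -
  define k where "k = K + nat \<lceil>ln (12 * (real N)\<^sup>2 / \<epsilon>)\<rceil>"
  have mk: "\<Gamma>\<^sub>2 k + 1 \<le> m" using m by (simp add: k_def)
  then have Km: "K \<le> m" using \<Gamma>2_ge[of k] by (simp add: k_def)
  have "dist (x (2 * K)) z \<le> 2 * real N"
    using z by (intro dist_in_ball iterates_bounded) (auto simp: approx_common_fix_def)
  then have "(dist (x (2 * K)) z)\<^sup>2 \<le> 4 * (real N)\<^sup>2"
    using power_mono[of "dist (x (2 * K)) z" "2 * real N" 2] by (simp add: power_mult_distrib)
  then have "(dist (x (2 * m)) z)\<^sup>2
    \<le> exp (- (\<Sum>i=K..<m. \<alpha> i)) * (4 * (real N)\<^sup>2) + \<epsilon> / 3 + (\<Sum>i=K..<m. 10 * real N * \<delta>)"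
    using Km \<alpha> \<delta> \<epsilon> K var
    by (intro halpern_recursion_bound[where a="\<lambda>m. (dist (x (2 * m)) z)\<^sup>2"] dist_approx_fix_step[OF z]) auto
  moreover have "(\<Sum>i=K..<m. 10 * real N * \<delta>) \<le> \<epsilon> / 3"
  proof -
    have "(\<Sum>i=K..<m. 10 * real N * \<delta>) = real (m - K) * (10 * real N * \<delta>)" by simp
    also have "\<dots> \<le> real m * (10 * real N * \<delta>)" using \<delta> by (intro mult_right_mono) auto
    finally show ?thesis using m\<delta> by linarith
  qed
  moreover have "exp (- (\<Sum>i=K..<m. \<alpha> i)) * (4 * (real N)\<^sup>2) \<le> \<epsilon> / 3"
  proof -
    have "ln (12 * (real N)\<^sup>2 / \<epsilon>) \<le> (\<Sum>i=K..<m. \<alpha> i)"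
      using mk Km by (intro sum_\<alpha>_ge[of _ _ k]) (auto simp: k_def of_nat_ceiling)
    then have "exp (- (\<Sum>i=K..<m. \<alpha> i)) \<le> exp (- ln (12 * (real N)\<^sup>2 / \<epsilon>))" by simp
    also have "\<dots> = \<epsilon> / (12 * (real N)\<^sup>2)" using \<epsilon> N by (simp add: exp_minus)
    finally show ?thesis using N by (simp add: field_simps)
  qed
  ultimately show ?thesis by linarith
qed

lemma metastability:
  assumes \<epsilon>: "0 < \<epsilon>"
  shows "\<exists>n\<le>mu N \<gamma> \<Gamma>\<^sub>1 \<Gamma>\<^sub>2 \<Gamma>\<^sub>3 \<Gamma>\<^sub>4 \<epsilon> f. \<forall>i\<in>{n..f n}. \<forall>j\<in>{n..f n}. dist (x i) (x j) \<le> \<epsilon>"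
proof -
  define e where "e = eps_tilde \<epsilon>"
  define \<Delta> where "\<Delta> = Delta_fun N \<gamma> \<Gamma>\<^sub>1 \<Gamma>\<^sub>2 \<Gamma>\<^sub>3 \<Gamma>\<^sub>4 \<epsilon> f"
  define \<Sigma> where "\<Sigma> = Sigma_bound N \<gamma> \<Gamma>\<^sub>1 \<Gamma>\<^sub>2 \<Gamma>\<^sub>3 \<Gamma>\<^sub>4 \<epsilon>"
  have e: "0 < e" using \<epsilon> by (simp add: e_def eps_tilde_def)
  have \<Delta>: "0 < \<Delta> n \<and> \<Delta> n \<le> 1" for n using e N by (simp add: \<Delta>_def Delta_fun_def e_def)
  obtain n0 z where n0: "n0 \<le> Psi_bound N \<gamma> \<Gamma>\<^sub>1 \<Gamma>\<^sub>2 \<Gamma>\<^sub>3 \<Gamma>\<^sub>4 (e / 24) \<Delta>"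
    and z: "z \<in> approx_common_fix (\<Delta> n0)"
    and var: "\<And>m. n0 \<le> m \<Longrightarrow> (dist u z)\<^sup>2 + (dist z (x m))\<^sup>2 - (dist u (x m))\<^sup>2 \<le> 2 * (e / 24)"
    using approx_projection_iterates[of "e / 24" \<Delta>] e \<Delta> by auto
  \<comment> \<open>\<open>n\<close> is chosen from \<open>n0\<close> as in the definition of \<open>P_bound\<close>, so \<open>f n\<close> bounds the number of steps
    for which the accuracy \<open>\<Delta> n0\<close> of \<open>z\<close> was designed.\<close>
  define n where "n = 2 * max (\<Sigma> n0) (\<theta>\<^sub>4 (\<epsilon> / 4)) + 1"
  define K where "K = K_bound N \<gamma> \<Gamma>\<^sub>1 \<Gamma>\<^sub>2 \<Gamma>\<^sub>3 \<Gamma>\<^sub>4 \<epsilon> n0"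
  have "\<Sigma> n0 \<le> \<Sigma> (Psi_bound N \<gamma> \<Gamma>\<^sub>1 \<Gamma>\<^sub>2 \<Gamma>\<^sub>3 \<Gamma>\<^sub>4 (e / 24) \<Delta>)"
    unfolding \<Sigma>_def Sigma_bound_def K_bound_def using n0
    by (intro add_mono monoD[OF \<Gamma>2]) auto
  then have n_le: "n \<le> mu N \<gamma> \<Gamma>\<^sub>1 \<Gamma>\<^sub>2 \<Gamma>\<^sub>3 \<Gamma>\<^sub>4 \<epsilon> f"
    unfolding n_def mu_def \<Sigma>_def e_def \<Delta>_def by simp
  have P: "P_bound N \<gamma> \<Gamma>\<^sub>1 \<Gamma>\<^sub>2 \<Gamma>\<^sub>3 \<Gamma>\<^sub>4 \<epsilon> f n0 = f n" by (simp add: P_bound_def n_def \<Sigma>_def)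
  have close: "dist (x (2 * m)) z \<le> \<epsilon> / 4" if m: "\<Sigma> n0 \<le> m" "m \<le> f n" for m
  proof -
    have "(dist (x (2 * m)) z)\<^sup>2 \<le> e"
    proof (rule dist_approx_fix_le[OF z, where K=K])
      show "\<rho>\<^sub>3 (e / (36 * real N)) \<le> K" by (simp add: K_def K_bound_def e_def)
      show "\<Gamma>\<^sub>2 (K + nat \<lceil>ln (12 * (real N)\<^sup>2 / e)\<rceil>) + 1 \<le> m"
        using m by (simp add: \<Sigma>_def Sigma_bound_def K_def e_def)
      show "(dist u z)\<^sup>2 + (dist z (x (2 * k)))\<^sup>2 - (dist u (x (2 * k)))\<^sup>2 \<le> e / 12" if "K \<le> k" for k
        using var[of "2 * k"] that by (simp add: K_def K_bound_def)
      have "real m * (10 * real N * \<Delta> n0)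
        \<le> (real (f n) + 1) * (10 * real N * (e / (30 * real N * (real (f n) + 1))))"
        using m \<Delta>[of n0] by (intro mult_mono) (auto simp: \<Delta>_def Delta_fun_def P e_def)
      also have "\<dots> = e / 3"
      proof -
        have "s * (10 * real N * (e / (30 * real N * s))) = e / 3" if "s \<noteq> 0" for s
          using that N(1) by (simp add: field_simps)
        then show ?thesis by (simp add: add_nonneg_eq_0_iff)
      qed
      finally show "real m * (10 * real N * \<Delta> n0) \<le> e / 3" .
    qed (use \<Delta>[of n0] e in auto)
    also have "e = (\<epsilon> / 4)\<^sup>2" by (simp add: e_def eps_tilde_def power_divide)
    finally show ?thesis using \<epsilon> by simp
  qed
  have all: "dist (x i) z \<le> \<epsilon> / 2" if i: "i \<in> {n..f n}" for i
  proof (cases i rule: even_odd_cases)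
    case (even m)
    then have "\<Sigma> n0 \<le> m" "m \<le> f n" using i by (auto simp: n_def)
    then show ?thesis using close[of m] \<epsilon> even by simp
  next
    case (odd m)
    then have m: "\<Sigma> n0 \<le> m" "\<theta>\<^sub>4 (\<epsilon> / 4) \<le> m" "m \<le> f n" using i by (auto simp: n_def)
    have "dist (x (2 * m + 1)) (x (2 * m)) \<le> \<epsilon> / 4" using even_odd_gap_le[of "\<epsilon> / 4" m] m \<epsilon> by simp
    then show ?thesis
      using close[OF m(1,3)] dist_triangle[of "x (2 * m + 1)" z "x (2 * m)"] odd by simp
  qed
  have "dist (x i) (x j) \<le> \<epsilon>" if "i \<in> {n..f n}" "j \<in> {n..f n}" for i j
    using all[OF that(1)] all[OF that(2)] dist_triangle2[of "x i" "x j" z] by linarith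
  with n_le show ?thesis by blast
qed

end

theorem theorem5p1:
  fixes W :: "'a::metric_space \<Rightarrow> 'a \<Rightarrow> real \<Rightarrow> 'a"
    and C :: "'a set" and T U :: "'a \<Rightarrow> 'a"
    and \<alpha> \<beta> :: "nat \<Rightarrow> real" and u x0 :: 'a and x :: "nat \<Rightarrow> 'a"
    and \<Gamma>\<^sub>1 \<Gamma>\<^sub>3 \<Gamma>\<^sub>4 :: "real \<Rightarrow> nat" and \<Gamma>\<^sub>2 :: "nat \<Rightarrow> nat"
    and \<gamma> :: real and N :: nat
  assumes "cat0_space W"
    and "C \<noteq> {}" and "geodesically_convex W C"
    and "T \<in> C \<rightarrow> C" and "U \<in> C \<rightarrow> C"
    and "nonexpansive_on C T" and "nonexpansive_on C U"
    and "Fix_on C T \<inter> Fix_on C U \<noteq> {}"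
    and "\<And>n. \<alpha> n \<in> {0..1}" and "\<And>n. \<beta> n \<in> {0..1}"
    and "u \<in> C" and "x0 \<in> C"
    and "antimono_on {0<..} \<Gamma>\<^sub>1" and "mono \<Gamma>\<^sub>2"
    and "antimono_on {0<..} \<Gamma>\<^sub>3" and "antimono_on {0<..} \<Gamma>\<^sub>4"
    and "\<gamma> \<in> {0<..<1}"
    and Q1: "\<And>\<epsilon> n. \<epsilon> > 0 \<Longrightarrow> n \<ge> \<Gamma>\<^sub>1 \<epsilon> \<Longrightarrow> \<alpha> n \<le> \<epsilon>"
    and Q2: "\<And>k. (\<Sum>i=0..\<Gamma>\<^sub>2 k. \<alpha> i) \<ge> real k"
    and Q3: "\<And>\<epsilon> n. \<epsilon> > 0 \<Longrightarrow> (\<Sum>i=\<Gamma>\<^sub>3 \<epsilon> + 1..\<Gamma>\<^sub>3 \<epsilon> + n. \<bar>\<alpha> (i + 1) - \<alpha> i\<bar>) \<le> \<epsilon>"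
    and Q4: "\<And>\<epsilon> n. \<epsilon> > 0 \<Longrightarrow> (\<Sum>i=\<Gamma>\<^sub>4 \<epsilon> + 1..\<Gamma>\<^sub>4 \<epsilon> + n. \<bar>\<beta> (i + 1) - \<beta> i\<bar>) \<le> \<epsilon>"
    and Q5: "\<And>n. \<gamma> \<le> \<beta> n \<and> \<beta> n \<le> 1 - \<gamma>"
    and "N \<noteq> 0"
    and "\<exists>p \<in> Fix_on C T \<inter> Fix_on C U. real N \<ge> max (dist x0 p) (2 * dist u p)"
    and "x 0 = x0"
    and "\<And>n. x (2 * n + 1) = W (T (x (2 * n))) u (\<alpha> n)"
    and "\<And>n. x (2 * n + 2) = W (U (x (2 * n + 1))) (x (2 * n + 1)) (\<beta> n)"
  shows "Cauchy x \<and> metastability_rate x (mu N \<gamma> \<Gamma>\<^sub>1 \<Gamma>\<^sub>2 \<Gamma>\<^sub>3 \<Gamma>\<^sub>4)"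
proof -
  obtain p where p: "p \<in> Fix_on C T \<inter> Fix_on C U" "real N \<ge> max (dist x0 p) (2 * dist u p)"
    using assms(24) by blast
  have "x 0 \<in> C" "0 < \<gamma>" "0 < N" "dist (x 0) p \<le> real N" "2 * dist u p \<le> real N"
    using assms(12,17,23,25) p(2) by auto
  note facts = this p(1) assms
  interpret halpern_mann W C T U \<alpha> \<beta> u p x \<Gamma>\<^sub>1 \<Gamma>\<^sub>3 \<Gamma>\<^sub>4 \<Gamma>\<^sub>2 \<gamma> N
    by (intro halpern_mann.intro halpern_mann_axioms.intro) (fact facts)+
  have "metastability_rate x (mu N \<gamma> \<Gamma>\<^sub>1 \<Gamma>\<^sub>2 \<Gamma>\<^sub>3 \<Gamma>\<^sub>4)"
    unfolding metastability_rate_def using metastability by blast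
  then show ?thesis using Cauchy_if_metastable by blast
qed

end
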